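(* Let $k\ge1$ and $n\ge 0$ be integers. If two $k$-component virtual string links $L$ and $L'$ are $L_{n+1}$-equivalent, then $L$ and $L'$ are $V_n$-equivalent.
   Context: **Gauss diagrams.** A Gauss diagram on $k$ strands consists of $k$ ordered oriented intervals together with finitely many arrows (oriented chords) with pairwise distinct endpoints in the interiors of the intervals, each arrow carrying a sign $\pm1$; diagrams are taken up to isotopy of the intervals. **Reidemeister moves.** RI: add or delete an arrow whose two endpoints are adjacent on an interval (any sign, either direction). RII: add or delete two arrows of opposite signs whose tails are adjacent and whose heads are adjacent (in any order). RIII: let $s_1,s_2,s_3$ be three disjoint segments of the intervals containing exactly the endpoints of three arrows of the same sign, $a$ from $s_1$ to $s_2$, $b$ from $s_1$ to $s_3$, $c$ from $s_2$ to $s_3$; the move exchanges the configuration in which the orders are $(a,b)$ on $s_1$, $(a,c)$ on $s_2$, $(b,c)$ on $s_3$ with the configuration in which the order is reversed on each of $s_1,s_2,s_3$. Two Gauss diagrams are equivalent ($\sim$) if related by a finite sequence of Reidemeister moves; an equivalence class $[D]$ of Gauss diagrams on $k$ strands is a $k$-component virtual string link, and $\mathcal{VSL}(k)$ is the set of these. **Pure virtual braid group.** $PV_m$ is the group generated by $\mu_{ij}$ ($1\le i,j\le m$, $i\ne j$) with relations $\mu_{ij}\mu_{il}\mu_{jl}=\mu_{jl}\mu_{il}\mu_{ij}$ for distinct $i,j,l$ and $\mu_{ij}\mu_{lp}=\mu_{lp}\mu_{ij}$ for distinct $i,j,l,p$. A word in the $\mu_{ij}^{\pm1}$ is drawn on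 $m$ vertical strands oriented from top to bottom, read from left to right as from top to bottom, $\mu_{ij}^{\epsilon}$ being a horizontal arrow of sign $\epsilon$ from the $i$-th to the $j$-th strand. Put $\Gamma_1(G)=G$, $\Gamma_n(G)=[\Gamma_{n-1}(G),G]$. **Attaching and $L_n$-equivalence.** Let $h\in PV_m$ be represented by a word, and let $e$ be an embedding of its $m$ strands onto $m$ pairwise disjoint segments of the intervals of $D$ containing no endpoints of arrows of $D$; each strand may be embedded preserving or reversing orientation. $D^{(h,e)}$ is obtained by adding to $D$ the images of the arrows of $h$, where the sign of an arrow is multiplied by $-1$ if exactly one of its two strands is orientation-reversed. Its equivalence class does not depend on the word. For $n\ge 1$, an $L_n$-move replaces $D$ by $D^{(h,e)}$, where $m\ge1$, $h\in\Gamma_n(PV_m)$ and $h\notin\Gamma_{n+1}(PV_m)$. Two Gauss diagrams (or the virtual string links they represent) are $L_n$-equivalent if they are related by a finite sequence of $L_n$-moves and Reidemeister moves. **Finite type invariants.** A dashed Gauss diagram on $k$ strands is a Gauss diagram with two types of signed arrows, ordinary and dashed; it is considered up to Reidemeister moves on ordinary arrows keeping the dashed arrows fixed. If $D$ has dashed arrows $a_1,\dots,a_r$, put $$\varphi([D])=\sum_{\epsilon_1,\dots,\epsilon_r\in\{\pm1\}}\epsilon_1\cdots\epsilon_r\,[D_{\epsilon_1,\dots,\epsilon_r}]\in\mathbb{Z}\mathcal{VSL}(k),$$ where $D_{\epsilon_1,\dots,\epsilon_r}$ is obtained from $D$ by replacing $a_i$ with an ordinary arrow of the same sign if $\epsilon_i=1$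 and deleting $a_i$ if $\epsilon_i=-1$. A map $f:\mathcal{VSL}(k)\to A$ to an abelian group $A$, extended linearly to $\mathbb{Z}\mathcal{VSL}(k)$, is a finite type invariant of degree $n$ if $f(\varphi([D]))=0$ for every dashed Gauss diagram $D$ on $k$ strands with more than $n$ dashed arrows. Two $k$-component virtual string links are $V_n$-equivalent if they are not distinguished by any finite type invariant of degree $n$ with values in any abelian group; equivalently, $L-L'\in J_{n+1}(k)$, where $J_{n+1}(k)$ is the subgroup of $\mathbb{Z}\mathcal{VSL}(k)$ generated by all $\varphi([D])$ with $D$ a dashed Gauss diagram on $k$ strands having exactly $n+1$ dashed arrows. *)

theory Defs
  imports "HOL-Algebra.Free_Abelian_Groups" "HOL-Algebra.Generated_Groups"
begin

section \<open>Gauss diagrams\<close>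

text \<open>
  A Gauss diagram on \<open>k\<close> strands is encoded by \<open>k\<close> lists: the \<open>c\<close>-th list gives the arrow
  endpoints met along the \<open>c\<close>-th interval, in the order of its orientation. An endpoint
  \<open>(a, t, s)\<close> carries the name \<open>a\<close> of its arrow, whether it is the tail or the head,
  and the sign \<open>s\<close> of the arrow. The positions are thereby taken up to isotopy;
  the names of the arrows are immaterial, see \<open>rename\<close> below.
\<close>

datatype kind = Tail | Head

type_synonym endpoint = "nat \<times> kind \<times> int"
type_synonym gauss_code = "endpoint list list"

definition arrows :: "gauss_code \<Rightarrow> nat set" where
  "arrows D = {a. \<exists>t s. (a, t, s) \<in> set (concat D)}"

definition gauss_diagram :: "nat \<Rightarrow> gauss_code \<Rightarrow> bool" where
  "gauss_diagram k D \<longleftrightarrow>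
     length D = k \<and>
     distinct (map (\<lambda>(a, t, s). (a, t)) (concat D)) \<and>
     (\<forall>(a, t, s) \<in> set (concat D). s \<in> {1, -1}) \<and>
     (\<forall>a s. (a, Tail, s) \<in> set (concat D) \<longleftrightarrow> (a, Head, s) \<in> set (concat D))"

definition rename :: "(nat \<Rightarrow> nat) \<Rightarrow> gauss_code \<Rightarrow> gauss_code" where
  "rename \<pi> D = map (map (\<lambda>(a, t, s). (\<pi> a, t, s))) D"

definition delete_arrows :: "nat set \<Rightarrow> gauss_code \<Rightarrow> gauss_code" where
  "delete_arrows X D = map (filter (\<lambda>(a, t, s). a \<notin> X)) D"


section \<open>Diagrams with marked segments\<close>

text \<open>
  A marked diagram records, besides endpoints, \<open>m\<close> pairwise disjoint segments of the intervals
  that contain no endpoint; the \<open>i\<close>-th segment is represented by the item \<open>Slot i\<close>.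
  Filling with the blocks \<open>bs\<close> places the endpoints \<open>bs ! i\<close> on the \<open>i\<close>-th segment.
\<close>

datatype item = End endpoint | Slot nat

type_synonym marked_code = "item list list"

definition slots :: "marked_code \<Rightarrow> nat list" where
  "slots T = concat (map (\<lambda>x. case x of End _ \<Rightarrow> [] | Slot i \<Rightarrow> [i]) (concat T))"

definition marking :: "nat \<Rightarrow> marked_code \<Rightarrow> bool" where
  "marking m T \<longleftrightarrow> distinct (slots T) \<and> set (slots T) = {..<m}"

definition fill :: "endpoint list list \<Rightarrow> marked_code \<Rightarrow> gauss_code" where
  "fill bs T =
     map (\<lambda>xs. concat (map (\<lambda>x. case x of End e \<Rightarrow> [e] | Slot i \<Rightarrow> bs ! i) xs)) T"

definition unmark :: "nat \<Rightarrow> marked_code \<Rightarrow> gauss_code" where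
  "unmark m T = fill (replicate m []) T"


section \<open>Reidemeister moves and virtual string links\<close>

text \<open>
  The moves are stated on arbitrary codes; only moves between two codes that are both
  Gauss diagrams are used below. This forces the added arrows to be pairwise different, to have
  names not yet in use, and to have signs \<open>\<plusminus>1\<close>. Each rule is oriented; inverse moves
  come from the equivalence closure.
\<close>

inductive move :: "gauss_code \<Rightarrow> gauss_code \<Rightarrow> bool" where
  isotopy:
    "inj_on \<pi> (arrows D) \<Longrightarrow> move D (rename \<pi> D)"
| RI:
    "marking 1 T \<Longrightarrow> b \<in> {[(a, Tail, s), (a, Head, s)], [(a, Head, s), (a, Tail, s)]} \<Longrightarrow>
     move (unmark 1 T) (fill [b] T)"
| RII:
    "marking 2 T \<Longrightarrow>
     ts \<in> {[(a, Tail, s), (b, Tail, - s)], [(b, Tail, - s), (a, Tail, s)]} \<Longrightarrow>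
     hs \<in> {[(a, Head, s), (b, Head, - s)], [(b, Head, - s), (a, Head, s)]} \<Longrightarrow>
     move (unmark 2 T) (fill [ts, hs] T)"
| RIII:
    "marking 3 T \<Longrightarrow>
     bs = [[(a, Tail, s), (b, Tail, s)], [(a, Head, s), (c, Tail, s)],
           [(b, Head, s), (c, Head, s)]] \<Longrightarrow>
     move (fill bs T) (fill (map rev bs) T)"

definition gauss_equiv :: "nat \<Rightarrow> gauss_code rel" where
  "gauss_equiv k = {(D, D'). gauss_diagram k D \<and> gauss_diagram k D' \<and>
     equivclp (\<lambda>D D'. gauss_diagram k D \<and> gauss_diagram k D' \<and> move D D') D D'}"

lemma equiv_gauss_equiv: "equiv {D. gauss_diagram k D} (gauss_equiv k)"
  by (rule equivI)
     (auto simp: gauss_equiv_def refl_on_def sym_def trans_def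
           intro: equivclp_sym equivclp_trans)

type_synonym vlink = "gauss_code set"

definition VSL :: "nat \<Rightarrow> vlink set" where
  "VSL k = {D. gauss_diagram k D} // gauss_equiv k"

definition link_class :: "nat \<Rightarrow> gauss_code \<Rightarrow> vlink" where
  "link_class k D = gauss_equiv k `` {D}"


section \<open>The pure virtual braid group\<close>

text \<open>
  The letter \<open>(i, j, \<epsilon>)\<close> stands for the generator \<open>\<mu>\<^sub>i\<^sub>j\<close> with exponent \<open>\<epsilon>\<close>. Strands are
  numbered from \<open>0\<close> to \<open>m - 1\<close>. The group presented by generators and relations is
  the quotient of the words in the generators and their inverses.
\<close>

type_synonym pv_word = "(nat \<times> nat \<times> int) list"

definition pv_words :: "nat \<Rightarrow> pv_word set" where
  "pv_words m = {w. \<forall>(i, j, \<epsilon>) \<in> set w. i < m \<and> j < m \<and> i \<noteq> j \<and> \<epsilon> \<in> {1, -1}}"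

inductive pv_step :: "pv_word \<Rightarrow> pv_word \<Rightarrow> bool" where
  cancel: "pv_step (u @ [(i, j, \<epsilon>), (i, j, - \<epsilon>)] @ v) (u @ v)"
| triple: "distinct [i, j, l] \<Longrightarrow>
    pv_step (u @ [(i, j, 1), (i, l, 1), (j, l, 1)] @ v)
            (u @ [(j, l, 1), (i, l, 1), (i, j, 1)] @ v)"
| commute: "distinct [i, j, l, p] \<Longrightarrow>
    pv_step (u @ [(i, j, 1), (l, p, 1)] @ v) (u @ [(l, p, 1), (i, j, 1)] @ v)"

definition pv_equiv :: "nat \<Rightarrow> pv_word rel" where
  "pv_equiv m = {(w, w'). w \<in> pv_words m \<and> w' \<in> pv_words m \<and>
     equivclp (\<lambda>w w'. w \<in> pv_words m \<and> w' \<in> pv_words m \<and> pv_step w w') w w'}"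

definition pv_class :: "nat \<Rightarrow> pv_word \<Rightarrow> pv_word set" where
  "pv_class m w = pv_equiv m `` {w}"

definition PV :: "nat \<Rightarrow> pv_word set monoid" where
  "PV m = \<lparr>carrier = pv_words m // pv_equiv m,
           monoid.mult = (\<lambda>X Y. \<Union>x\<in>X. \<Union>y\<in>Y. pv_class m (x @ y)),
           one = pv_class m []\<rparr>"

lemma equiv_pv_equiv: "equiv (pv_words m) (pv_equiv m)"
  by (rule equivI)
     (auto simp: pv_equiv_def refl_on_def sym_def trans_def
           intro: equivclp_sym equivclp_trans)

lemma pv_words_append [simp]:
  "u @ v \<in> pv_words m \<longleftrightarrow> u \<in> pv_words m \<and> v \<in> pv_words m"
  by (simp add: pv_words_def ball_Un)

lemma pv_words_Nil [simp]: "[] \<in> pv_words m"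
  by (simp add: pv_words_def)

lemma pv_step_context:
  assumes "pv_step w w'"
  shows "pv_step (u @ w @ v) (u @ w' @ v)"
  using assms
proof cases
  case (cancel p i j \<epsilon> q)
  show ?thesis
    using pv_step.cancel[of "u @ p" i j \<epsilon> "q @ v"] by (simp add: cancel)
next
  case (triple i j l p q)
  show ?thesis
    using pv_step.triple[of i j l "u @ p" "q @ v"] triple by simp
next
  case (commute i j l p' p q)
  show ?thesis
    using pv_step.commute[of i j l p' "u @ p" "q @ v"] commute by simp
qed

lemma pv_equiv_step:
  "pv_step w w' \<Longrightarrow> w \<in> pv_words m \<Longrightarrow> w' \<in> pv_words m \<Longrightarrow> (w, w') \<in> pv_equiv m"
  by (auto simp: pv_equiv_def intro: r_into_equivclp)

lemma pv_equiv_context: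
  assumes "(w, w') \<in> pv_equiv m" "u \<in> pv_words m" "v \<in> pv_words m"
  shows "(u @ w @ v, u @ w' @ v) \<in> pv_equiv m"
proof -
  let ?R = "\<lambda>w w'. w \<in> pv_words m \<and> w' \<in> pv_words m \<and> pv_step w w'"
  have "equivclp ?R w w'" using assms(1) by (simp add: pv_equiv_def)
  then have "equivclp ?R (u @ w @ v) (u @ w' @ v)"
  proof (induction rule: equivclp_induct)
    case base
    show ?case by simp
  next
    case (step y z)
    then have "equivclp ?R (u @ y @ v) (u @ z @ v)"
      using assms(2,3) pv_step_context[of _ _ u v]
      by (auto intro: r_into_equivclp converse_r_into_equivclp)
    then show ?case using step.IH by (rule equivclp_trans[rotated])
  qed
  with assms show ?thesis by (simp add: pv_equiv_def)
qed

lemma pv_equiv_append: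
  assumes "(x, x') \<in> pv_equiv m" "(y, y') \<in> pv_equiv m"
  shows "(x @ y, x' @ y') \<in> pv_equiv m"
proof -
  have "(x @ y, x' @ y) \<in> pv_equiv m"
    using pv_equiv_context[OF assms(1), of "[]" y] assms(2) by (simp add: pv_equiv_def)
  moreover have "(x' @ y, x' @ y') \<in> pv_equiv m"
    using pv_equiv_context[OF assms(2), of x' "[]"] assms(1) by (simp add: pv_equiv_def)
  ultimately show ?thesis
    unfolding pv_equiv_def by (auto intro: equivclp_trans)
qed

lemma pv_class_mult [simp]:
  assumes "x \<in> pv_words m" "y \<in> pv_words m"
  shows "pv_class m x \<otimes>\<^bsub>PV m\<^esub> pv_class m y = pv_class m (x @ y)"
proof -
  have "pv_class m (x' @ y') = pv_class m (x @ y)"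
    if "x' \<in> pv_class m x" "y' \<in> pv_class m y" for x' y'
  proof -
    have "(x @ y, x' @ y') \<in> pv_equiv m"
      using that by (intro pv_equiv_append) (simp_all add: pv_class_def)
    then show ?thesis
      unfolding pv_class_def by (rule equiv_class_eq[OF equiv_pv_equiv, symmetric])
  qed
  moreover have "x \<in> pv_class m x" "y \<in> pv_class m y"
    unfolding pv_class_def by (rule equiv_class_self[OF equiv_pv_equiv] assms)+
  ultimately have "(\<Union>x'\<in>pv_class m x. \<Union>y'\<in>pv_class m y. pv_class m (x' @ y')) =
      pv_class m (x @ y)"
    by blast
  then show ?thesis by (simp add: PV_def)
qed

lemma pv_carrier: "carrier (PV m) = pv_class m ` pv_words m"
  by (auto simp: PV_def pv_class_def quotient_def)

lemma pv_inverse_word: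
  assumes "w \<in> pv_words m"
  shows "\<exists>v \<in> pv_words m. pv_class m (v @ w) = pv_class m []"
  using assms
proof (induction w)
  case Nil
  then show ?case by (intro bexI[of _ "[]"]) auto
next
  case (Cons x w)
  obtain i j \<epsilon> where x: "x = (i, j, \<epsilon>)" by (cases x)
  have w: "w \<in> pv_words m" and e: "[(i, j, - \<epsilon>), x] \<in> pv_words m"
    using Cons.prems by (auto simp: pv_words_def x)
  obtain v where v: "v \<in> pv_words m" "pv_class m (v @ w) = pv_class m []"
    using Cons.IH w by blast
  have "pv_step (v @ [(i, j, - \<epsilon>), x] @ w) (v @ w)"
    using pv_step.cancel[of v i j "- \<epsilon>" w] by (simp add: x)
  then have "(v @ [(i, j, - \<epsilon>), x] @ w, v @ w) \<in> pv_equiv m"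
    using v(1) w e by (intro pv_equiv_step) (simp_all only: pv_words_append simp_thms)
  then have "pv_class m (v @ [(i, j, - \<epsilon>), x] @ w) = pv_class m (v @ w)"
    unfolding pv_class_def by (rule equiv_class_eq[OF equiv_pv_equiv])
  then have "pv_class m (v @ [(i, j, - \<epsilon>), x] @ w) = pv_class m []"
    using v(2) by (rule trans)
  moreover have "v @ [(i, j, - \<epsilon>)] \<in> pv_words m"
    using v(1) e pv_words_append[of "[(i, j, - \<epsilon>)]" "[x]" m] by simp
  ultimately show ?case by (intro bexI[of _ "v @ [(i, j, - \<epsilon>)]"]) simp_all
qed

lemma group_PV: "group (PV m)"
proof (rule groupI)
  have one: "\<one>\<^bsub>PV m\<^esub> = pv_class m []" by (simp add: PV_def)
  show "\<one>\<^bsub>PV m\<^esub> \<in> carrier (PV m)" by (simp add: one pv_carrier)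
  fix x assume "x \<in> carrier (PV m)"
  then obtain u where u: "u \<in> pv_words m" and x: "x = pv_class m u"
    unfolding pv_carrier by (rule imageE)
  obtain v where v: "v \<in> pv_words m" "pv_class m (v @ u) = pv_class m []"
    using pv_inverse_word[OF u] by (rule bexE)
  show "\<one>\<^bsub>PV m\<^esub> \<otimes>\<^bsub>PV m\<^esub> x = x" by (simp add: one x u)
  show "\<exists>y\<in>carrier (PV m). y \<otimes>\<^bsub>PV m\<^esub> x = \<one>\<^bsub>PV m\<^esub>"
    by (rule bexI[of _ "pv_class m v"]) (simp_all add: one x u v pv_carrier)
  fix y assume "y \<in> carrier (PV m)"
  then obtain v where v: "v \<in> pv_words m" and y: "y = pv_class m v"
    unfolding pv_carrier by (rule imageE)
  show "x \<otimes>\<^bsub>PV m\<^esub> y \<in> carrier (PV m)" by (simp add: x y u v pv_carrier)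
  fix z assume "z \<in> carrier (PV m)"
  then obtain w where w: "w \<in> pv_words m" and z: "z = pv_class m w"
    unfolding pv_carrier by (rule imageE)
  show "x \<otimes>\<^bsub>PV m\<^esub> y \<otimes>\<^bsub>PV m\<^esub> z = x \<otimes>\<^bsub>PV m\<^esub> (y \<otimes>\<^bsub>PV m\<^esub> z)"
    by (simp add: x y z u v w)
qed

text \<open>
  \<open>lower_central G n\<close> is \<open>\<Gamma>\<^sub>n(G)\<close> for \<open>n \<ge> 1\<close>; the value at \<open>n = 0\<close> is a convention
  that is not used.
\<close>

fun lower_central :: "('a, 'b) monoid_scheme \<Rightarrow> nat \<Rightarrow> 'a set" where
  "lower_central G 0 = carrier G"
| "lower_central G (Suc 0) = carrier G"
| "lower_central G (Suc (Suc n)) =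
     generate G {x \<otimes>\<^bsub>G\<^esub> y \<otimes>\<^bsub>G\<^esub> inv\<^bsub>G\<^esub> x \<otimes>\<^bsub>G\<^esub> inv\<^bsub>G\<^esub> y |x y.
       x \<in> lower_central G (Suc n) \<and> y \<in> carrier G}"


section \<open>Attaching and \<open>L\<^sub>n\<close>-equivalence\<close>

text \<open>
  \<open>strand_block w lab \<rho> p\<close> lists the endpoints on the image of strand \<open>p\<close> of the word \<open>w\<close>,
  in the order of the interval containing it; \<open>\<rho> p\<close> says that strand \<open>p\<close> is embedded
  reversing its orientation, and \<open>lab l\<close> is the name of the arrow given by the \<open>l\<close>-th letter.
\<close>

definition strand_block ::
  "pv_word \<Rightarrow> (nat \<Rightarrow> nat) \<Rightarrow> (nat \<Rightarrow> bool) \<Rightarrow> nat \<Rightarrow> endpoint list" where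
  "strand_block w lab \<rho> p =
     (if \<rho> p then rev else id)
       (concat (map (\<lambda>l. case w ! l of (i, j, \<epsilon>) \<Rightarrow>
            let s = (if \<rho> i \<noteq> \<rho> j then - \<epsilon> else \<epsilon>) in
            if p = i then [(lab l, Tail, s)] else if p = j then [(lab l, Head, s)] else [])
          [0..<length w]))"

definition attach ::
  "nat \<Rightarrow> pv_word \<Rightarrow> (nat \<Rightarrow> nat) \<Rightarrow> (nat \<Rightarrow> bool) \<Rightarrow> marked_code \<Rightarrow> gauss_code" where
  "attach m w lab \<rho> T = fill (map (strand_block w lab \<rho>) [0..<m]) T"

text \<open>
  The embedding \<open>e\<close> is the pair \<open>(T, \<rho>)\<close>, where \<open>unmark m T\<close> is the diagram \<open>D\<close>. Since
  \<open>D'\<close> is a Gauss diagram, \<open>lab\<close> is injective on \<open>{..<length w}\<close> and takes values outside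
  \<open>arrows D\<close> there.
\<close>

definition L_move :: "nat \<Rightarrow> nat \<Rightarrow> gauss_code \<Rightarrow> gauss_code \<Rightarrow> bool" where
  "L_move k n D D' \<longleftrightarrow>
     gauss_diagram k D \<and> gauss_diagram k D' \<and>
     (\<exists>m w lab \<rho> T. m \<ge> 1 \<and> w \<in> pv_words m \<and>
        pv_class m w \<in> lower_central (PV m) n \<and>
        pv_class m w \<notin> lower_central (PV m) (Suc n) \<and>
        marking m T \<and> D = unmark m T \<and> D' = attach m w lab \<rho> T)"

definition L_equiv_diagrams :: "nat \<Rightarrow> nat \<Rightarrow> gauss_code \<Rightarrow> gauss_code \<Rightarrow> bool" where
  "L_equiv_diagrams k n D D' \<longleftrightarrow>
     gauss_diagram k D \<and> gauss_diagram k D' \<and>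
     equivclp (\<lambda>D D'. gauss_diagram k D \<and> gauss_diagram k D' \<and> (move D D' \<or> L_move k n D D'))
       D D'"

definition L_equivalent :: "nat \<Rightarrow> nat \<Rightarrow> vlink \<Rightarrow> vlink \<Rightarrow> bool" where
  "L_equivalent k n L L' \<longleftrightarrow> (\<exists>D\<in>L. \<exists>D'\<in>L'. L_equiv_diagrams k n D D')"


section \<open>Finite type invariants and \<open>V\<^sub>n\<close>-equivalence\<close>

text \<open>
  A dashed Gauss diagram is a Gauss diagram \<open>D\<close> together with the set \<open>X\<close> of names of its
  dashed arrows; \<open>\<phi>\<close> is given on representatives.
\<close>

definition dashed_diagram :: "nat \<Rightarrow> gauss_code \<Rightarrow> nat set \<Rightarrow> bool" where
  "dashed_diagram k D X \<longleftrightarrow> gauss_diagram k D \<and> X \<subseteq> arrows D"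

definition phi :: "nat \<Rightarrow> gauss_code \<Rightarrow> nat set \<Rightarrow> vlink \<Rightarrow>\<^sub>0 int" where
  "phi k D X =
     (\<Sum>\<epsilon> \<in> X \<rightarrow>\<^sub>E {1, -1 :: int}.
        frag_cmul (\<Prod>a\<in>X. \<epsilon> a) (frag_of (link_class k (delete_arrows {a \<in> X. \<epsilon> a = -1} D))))"

text \<open>Linear extension; the abelian group \<open>A\<close> is written multiplicatively.\<close>

definition linear_ext ::
  "('a, 'b) monoid_scheme \<Rightarrow> ('c \<Rightarrow> 'a) \<Rightarrow> ('c \<Rightarrow>\<^sub>0 int) \<Rightarrow> 'a" where
  "linear_ext A f c =
     (\<Otimes>\<^bsub>A\<^esub>x \<in> Poly_Mapping.keys c. f x [^]\<^bsub>A\<^esub> Poly_Mapping.lookup c x)"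

definition finite_type_invariant ::
  "('a, 'b) monoid_scheme \<Rightarrow> nat \<Rightarrow> nat \<Rightarrow> (vlink \<Rightarrow> 'a) \<Rightarrow> bool" where
  "finite_type_invariant A k n f \<longleftrightarrow>
     f \<in> VSL k \<rightarrow> carrier A \<and>
     (\<forall>D X. dashed_diagram k D X \<and> card X > n \<longrightarrow> linear_ext A f (phi k D X) = \<one>\<^bsub>A\<^esub>)"

text \<open>
  HOL cannot quantify over types inside a formula, so the type of the elements of the target
  groups is a parameter; a statement about \<open>V_equivalent TYPE('a)\<close> with \<open>'a\<close> a type variable
  covers all abelian groups.
\<close>

definition V_equivalent :: "'a itself \<Rightarrow> nat \<Rightarrow> nat \<Rightarrow> vlink \<Rightarrow> vlink \<Rightarrow> bool" where
  "V_equivalent _ k n L L' \<longleftrightarrow>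
     (\<forall>(A :: 'a monoid) f. comm_group A \<and> finite_type_invariant A k n f \<longrightarrow> f L = f L')"

end

theory Submission
  imports Defs "HOL-Library.Multiset"
begin

text \<open>
  Attaching words \<open>w\<close> along a fixed embedding turns a map \<open>f\<close> on virtual string links into a map
  \<open>F\<close> on the pure virtual braid group. If \<open>f\<close> is of finite type of degree \<open>n\<close>, then \<open>F\<close>, extended
  linearly to the group ring, vanishes on the \<open>(n + 1)\<close>-st power of the augmentation ideal, and
  \<open>h - 1\<close> lies in this power for \<open>h \<in> \<Gamma>\<^sub>n\<^sub>+\<^sub>1\<close>. Hence an \<open>L\<^sub>n\<^sub>+\<^sub>1\<close>-move does not change \<open>f\<close>.

  The map \<open>F\<close> is well defined because every relation of the group is realised by Reidemeister
  moves (\<open>attached_class_equiv\<close>). Cancellation is an RII move. The triple relation is an RIII move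
  only when none or all of the strands are reversed: otherwise the signs of the three arrows differ,
  and for a reversed middle strand the resulting triangle does not even come from a word on three
  strands that all run downwards. The remaining triangle moves are obtained from RIII by changing one
  arrow at a time: a cancelling pair is introduced by RII, its inner arrow takes part in the
  known triangle move and then cancels with the arrow to be changed
  (\<open>interchangeable_switch_arrow\<close>). All moves are local, so they are proved for the contents of
  segments and carried to any diagram by refining its marked segments
  (\<open>interchangeable_refine\<close>).

  When the last letters of an attached word are dashed, \<open>\<phi>\<close> is the iterated difference, along these
  letters, of the map that takes a word to the link obtained by attaching it (\<open>phi_attached\<close>). So all
  \<open>(n + 1)\<close>-fold differences of \<open>F\<close> along generators vanish. Differences along an element of
  \<open>\<Gamma>\<^sub>r\<close> count like \<open>r\<close> differences along generators, by the identity
  \<open>x y x\<inverse> y\<inverse> - 1 = ((x - 1) (y - 1) - (y - 1) (x - 1)) x\<inverse> y\<inverse>\<close>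
  (\<open>lower_central_diff_map\<close>). Instead of the group ring and its ideals, the maps annihilated by
  them are used throughout.
\<close>

section \<open>Endpoints that pair up into arrows\<close>

text \<open>
  Everything that \<open>gauss_diagram\<close> asks of a code beyond its number of strands depends on the
  multiset of its endpoints only. The condition is therefore isolated on flat lists, where it can be
  transported along permutations.
\<close>

definition paired :: "endpoint list \<Rightarrow> bool" where
  "paired es \<longleftrightarrow>
     distinct (map (\<lambda>(a, t, s). (a, t)) es) \<and>
     (\<forall>(a, t, s) \<in> set es. s \<in> {1, -1}) \<and>
     (\<forall>a s. (a, Tail, s) \<in> set es \<longleftrightarrow> (a, Head, s) \<in> set es)"

lemma gauss_diagram_paired: "gauss_diagram k D \<longleftrightarrow> length D = k \<and> paired (concat D)"
  by (auto simp: gauss_diagram_def paired_def)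

lemma paired_mset:
  assumes "mset es = mset es'"
  shows "paired es \<longleftrightarrow> paired es'"
proof -
  have "set es = set es'"
    using assms by (rule mset_eq_setD)
  moreover have "distinct (map f es) \<longleftrightarrow> distinct (map f es')" for f :: "endpoint \<Rightarrow> nat \<times> kind"
    by (rule mset_eq_imp_distinct_iff) (simp add: assms)
  ultimately show ?thesis
    by (simp add: paired_def)
qed

lemma paired_cong: "mset es = mset es' \<Longrightarrow> paired es \<Longrightarrow> paired es'"
  using paired_mset by blast

lemma paired_add_arrow:
  "paired ((a, Tail, s) # (a, Head, s) # es) \<longleftrightarrow> s \<in> {1, -1} \<and> a \<notin> fst ` set es \<and> paired es"
  (is "?l \<longleftrightarrow> ?r")
proof (cases "a \<in> fst ` set es")
  case True
  then obtain t r where *: "(a, t, r) \<in> set es" by auto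
  have "(a, t) \<in> (\<lambda>(a, t, s). (a, t)) ` set es"
    using * by (rule rev_image_eqI) simp
  then have "\<not> ?l"
    by (cases t) (simp_all add: paired_def)
  then show ?thesis using True by simp
next
  case False
  then have *: "(a, t, r) \<notin> set es" for t r by force
  then have "(a, t) \<notin> (\<lambda>(a, t, s). (a, t)) ` set es" for t by force
  moreover have "(\<forall>b r. (b, Tail, r) \<in> set ((a, Tail, s) # (a, Head, s) # es) \<longleftrightarrow>
        (b, Head, r) \<in> set ((a, Tail, s) # (a, Head, s) # es)) \<longleftrightarrow>
      (\<forall>b r. (b, Tail, r) \<in> set es \<longleftrightarrow> (b, Head, r) \<in> set es)"
    using * by (intro iff_allI) auto
  ultimately show ?thesis
    using False by (simp add: paired_def conj_ac)
qed

section \<open>Filling and refining marked segments\<close>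

fun ends :: "item list \<Rightarrow> endpoint list" where
  "ends [] = []"
| "ends (End e # xs) = e # ends xs"
| "ends (Slot i # xs) = ends xs"

fun item_slots :: "item list \<Rightarrow> nat list" where
  "item_slots [] = []"
| "item_slots (End e # xs) = item_slots xs"
| "item_slots (Slot i # xs) = i # item_slots xs"

fun fill_items :: "endpoint list list \<Rightarrow> item list \<Rightarrow> endpoint list" where
  "fill_items bs [] = []"
| "fill_items bs (End e # xs) = e # fill_items bs xs"
| "fill_items bs (Slot i # xs) = bs ! i @ fill_items bs xs"

text \<open>
  Refinement replaces each marked segment by a row of endpoints and smaller marked segments. It is
  how a local pattern inside larger blocks becomes a marking to which a move applies.
\<close>

fun refine_items :: "item list list \<Rightarrow> item list \<Rightarrow> item list" where
  "refine_items Bs [] = []"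
| "refine_items Bs (End e # xs) = End e # refine_items Bs xs"
| "refine_items Bs (Slot i # xs) = Bs ! i @ refine_items Bs xs"

lemma ends_append [simp]: "ends (xs @ ys) = ends xs @ ends ys"
  by (induction xs rule: ends.induct) auto

lemma item_slots_append [simp]: "item_slots (xs @ ys) = item_slots xs @ item_slots ys"
  by (induction xs rule: item_slots.induct) auto

lemma fill_items_append [simp]: "fill_items bs (xs @ ys) = fill_items bs xs @ fill_items bs ys"
  by (induction xs rule: item_slots.induct) auto

lemma ends_map_End [simp]: "ends (map End es) = es"
  by (induction es) auto

lemma item_slots_map_End [simp]: "item_slots (map End es) = []"
  by (induction es) auto

lemma fill_items_map_End [simp]: "fill_items bs (map End es) = es"
  by (induction es) auto

lemma item_slots_concat: "item_slots (concat T) = concat (map item_slots T)"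
  by (induction T) auto

lemma set_item_slots_concat: "set (item_slots (concat T)) = (\<Union>xs\<in>set T. set (item_slots xs))"
  by (simp add: item_slots_concat)

lemma slots_eq: "slots T = item_slots (concat T)"
proof -
  have "concat (map (\<lambda>x. case x of End _ \<Rightarrow> [] | Slot i \<Rightarrow> [i]) xs) = item_slots xs" for xs
    by (induction xs rule: item_slots.induct) auto
  then show ?thesis by (simp add: slots_def)
qed

lemma fill_eq: "fill bs T = map (fill_items bs) T"
proof -
  have "concat (map (\<lambda>x. case x of End e \<Rightarrow> [e] | Slot i \<Rightarrow> bs ! i) xs) = fill_items bs xs" for xs
    by (induction xs rule: item_slots.induct) auto
  then show ?thesis by (simp add: fill_def)
qed

lemma concat_fill: "concat (fill bs T) = fill_items bs (concat T)"
  by (induction T) (auto simp: fill_eq)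

lemma length_fill [simp]: "length (fill bs T) = length T"
  by (simp add: fill_eq)

lemma marking_mset: "marking m T \<longleftrightarrow> mset (slots T) = mset [0..<m]"
proof
  assume "marking m T"
  then show "mset (slots T) = mset [0..<m]"
    using set_eq_iff_mset_eq_distinct[of "slots T" "[0..<m]"]
    by (simp add: marking_def atLeast0LessThan del: mset_upt)
next
  assume *: "mset (slots T) = mset [0..<m]"
  show "marking m T"
    using mset_eq_setD[OF *] mset_eq_imp_distinct_iff[OF *] by (simp add: marking_def atLeast0LessThan)
qed

lemma mset_fill_items:
  "mset (fill_items bs xs) = mset (ends xs) + (\<Sum>i\<in>#mset (item_slots xs). mset (bs ! i))"
  by (induction xs rule: item_slots.induct) (auto simp: ac_simps)

lemma mset_item_slots_refine:
  "mset (item_slots (refine_items Bs xs)) = (\<Sum>i\<in>#mset (item_slots xs). mset (item_slots (Bs ! i)))"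
  by (induction xs rule: item_slots.induct) auto

lemma sum_mset_nth: "(\<Sum>i\<in>#mset [0..<length xs]. mset (f (xs ! i))) = mset (concat (map f xs))"
proof -
  have "mset (concat (map f xs)) = (\<Sum>x\<in>#mset xs. mset (f x))"
    by (induction xs) auto
  also have "mset xs = {# xs ! i. i \<in># mset [0..<length xs] #}"
    by (metis map_nth mset_map)
  finally show ?thesis by (simp add: image_mset.compositionality comp_def)
qed

text \<open>
  Each segment occurs exactly once, so filling contributes every block exactly once. Consequently
  permuting endpoints within the blocks preserves Gauss diagrams.
\<close>

lemma mset_fill:
  assumes "marking (length bs) T"
  shows "mset (concat (fill bs T)) = mset (ends (concat T)) + mset (concat bs)"
  using assms sum_mset_nth[of "\<lambda>x. x" bs]
  by (simp add: concat_fill mset_fill_items marking_mset slots_eq)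

lemma gauss_fill:
  assumes "marking (length bs) T"
  shows "gauss_diagram k (fill bs T) \<longleftrightarrow> length T = k \<and> paired (concat bs @ ends (concat T))"
  using mset_fill[OF assms] paired_mset[of "concat (fill bs T)" "concat bs @ ends (concat T)"]
  by (simp add: gauss_diagram_paired)

lemma fill_items_refine:
  "\<forall>i\<in>set (item_slots xs). i < length Bs \<Longrightarrow>
   fill_items cs (refine_items Bs xs) = fill_items (map (fill_items cs) Bs) xs"
  by (induction xs rule: item_slots.induct) auto

lemma marking_less: "marking m T \<Longrightarrow> i \<in> set (slots T) \<Longrightarrow> i < m"
  by (auto simp: marking_def)

lemma item_slots_refine_concat:
  "item_slots (concat (map (refine_items Bs) T)) = item_slots (refine_items Bs (concat T))"
proof -
  have "refine_items Bs (xs @ ys) = refine_items Bs xs @ refine_items Bs ys" for xs ys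
    by (induction xs rule: item_slots.induct) auto
  then have "concat (map (refine_items Bs) T) = refine_items Bs (concat T)"
    by (induction T) auto
  then show ?thesis by simp
qed

lemma marking_refine:
  assumes "marking (length Bs) T" "mset (item_slots (concat Bs)) = mset [0..<q]"
  shows "marking q (map (refine_items Bs) T)"
  using assms sum_mset_nth[of item_slots Bs]
  by (simp add: item_slots_concat[of Bs] marking_mset slots_eq item_slots_refine_concat
      mset_item_slots_refine)

lemma fill_refine:
  assumes "marking (length Bs) T"
  shows "fill cs (map (refine_items Bs) T) = fill (map (fill_items cs) Bs) T"
proof -
  have "fill_items cs (refine_items Bs xs) = fill_items (map (fill_items cs) Bs) xs"
    if "xs \<in> set T" for xs
    using marking_less[OF assms] that
    by (intro fill_items_refine) (simp add: slots_eq set_item_slots_concat, blast)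
  then show ?thesis by (simp add: fill_eq)
qed

section \<open>Interchangeable blocks\<close>

text \<open>
  A local move in terms of the contents of the segments alone. Both fillings are required to be
  Gauss diagrams. So moves can be stated for blocks without freshness conditions on the arrow
  names, and the relation is symmetric.
\<close>

definition interchangeable :: "nat \<Rightarrow> endpoint list list \<Rightarrow> endpoint list list \<Rightarrow> bool" where
  "interchangeable k bs bs' \<longleftrightarrow> length bs = length bs' \<and>
     (\<forall>T. marking (length bs) T \<and> gauss_diagram k (fill bs T) \<and> gauss_diagram k (fill bs' T) \<longrightarrow>
        (fill bs T, fill bs' T) \<in> gauss_equiv k)"

lemma gauss_equiv_refl: "gauss_diagram k D \<Longrightarrow> (D, D) \<in> gauss_equiv k"
  by (simp add: gauss_equiv_def)

lemma gauss_equiv_sym: "(D, D') \<in> gauss_equiv k \<Longrightarrow> (D', D) \<in> gauss_equiv k"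
  by (auto simp: gauss_equiv_def intro: equivclp_sym)

lemma gauss_equiv_trans:
  "(D, D') \<in> gauss_equiv k \<Longrightarrow> (D', D'') \<in> gauss_equiv k \<Longrightarrow> (D, D'') \<in> gauss_equiv k"
  by (auto simp: gauss_equiv_def intro: equivclp_trans)

lemma gauss_equiv_move:
  "move D D' \<Longrightarrow> gauss_diagram k D \<Longrightarrow> gauss_diagram k D' \<Longrightarrow> (D, D') \<in> gauss_equiv k"
  by (auto simp: gauss_equiv_def intro: r_into_equivclp)

lemma interchangeable_sym: "interchangeable k bs bs' \<Longrightarrow> interchangeable k bs' bs"
  by (auto simp: interchangeable_def intro: gauss_equiv_sym)

lemma interchangeable_fill:
  assumes "interchangeable k bs bs'" "marking (length bs) T"
    "gauss_diagram k (fill bs T)" "gauss_diagram k (fill bs' T)"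
  shows "(fill bs T, fill bs' T) \<in> gauss_equiv k"
  using assms by (auto simp: interchangeable_def)

text \<open>
  A move between the contents of small segments is also one between larger blocks that
  contain them: the larger blocks arise by filling the refined marking.
\<close>

lemma interchangeable_refine:
  assumes "interchangeable k cs cs'" "mset (item_slots (concat Bs)) = mset [0..<length cs]"
  shows "interchangeable k (map (fill_items cs) Bs) (map (fill_items cs') Bs)"
  unfolding interchangeable_def
proof (intro conjI allI impI)
  fix T
  let ?T = "map (refine_items Bs) T"
  assume *: "marking (length (map (fill_items cs) Bs)) T \<and>
    gauss_diagram k (fill (map (fill_items cs) Bs) T) \<and>
    gauss_diagram k (fill (map (fill_items cs') Bs) T)"
  then have T: "marking (length Bs) T" by simp
  show "(fill (map (fill_items cs) Bs) T, fill (map (fill_items cs') Bs) T) \<in> gauss_equiv k"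
    using interchangeable_fill[OF assms(1) marking_refine[OF T assms(2)]] * fill_refine[OF T]
    by simp
qed simp

lemma interchangeable_RII:
  assumes "ts \<in> {[(a, Tail, s), (b, Tail, - s)], [(b, Tail, - s), (a, Tail, s)]}"
    and "hs \<in> {[(a, Head, s), (b, Head, - s)], [(b, Head, - s), (a, Head, s)]}"
  shows "interchangeable k [[], []] [ts, hs]"
  unfolding interchangeable_def
proof (intro conjI allI impI)
  fix T
  assume *: "marking (length [[], []]) T \<and>
    gauss_diagram k (fill [[], []] T) \<and> gauss_diagram k (fill [ts, hs] T)"
  then have "marking 2 T" by (simp add: numeral_2_eq_2)
  then have "move (fill [[], []] T) (fill [ts, hs] T)"
    using move.RII[OF _ assms, of T] by (simp add: unmark_def numeral_2_eq_2)
  then show "(fill [[], []] T, fill [ts, hs] T) \<in> gauss_equiv k"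
    using * by (intro gauss_equiv_move) simp_all
qed simp

lemma interchangeable_RIII:
  assumes "bs = [[(a, Tail, s), (b, Tail, s)], [(a, Head, s), (c, Tail, s)],
           [(b, Head, s), (c, Head, s)]]"
  shows "interchangeable k bs (map rev bs)"
  unfolding interchangeable_def
proof (intro conjI allI impI)
  fix T
  assume *: "marking (length bs) T \<and>
    gauss_diagram k (fill bs T) \<and> gauss_diagram k (fill (map rev bs) T)"
  then have "marking 3 T" by (simp add: assms numeral_3_eq_3)
  then have "move (fill bs T) (fill (map rev bs) T)"
    using assms by (rule move.RIII)
  then show "(fill bs T, fill (map rev bs) T) \<in> gauss_equiv k"
    using * by (intro gauss_equiv_move) simp_all
qed simp

lemma link_class_eq: "(D, D') \<in> gauss_equiv k \<Longrightarrow> link_class k D = link_class k D'"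
  unfolding link_class_def by (rule equiv_class_eq[OF equiv_gauss_equiv])

lemma arrows_eq: "arrows D = fst ` set (concat D)"
  unfolding arrows_def by force

lemma gauss_equiv_rename:
  assumes "inj_on \<pi> (arrows D)" "gauss_diagram k D" "gauss_diagram k (rename \<pi> D)"
  shows "(D, rename \<pi> D) \<in> gauss_equiv k"
  using assms by (intro gauss_equiv_move move.isotopy)

text \<open>
  Renaming and deleting arrows act on each endpoint separately, hence are homomorphisms of lists
  and pass through the filling.
\<close>

lemma map_fill:
  assumes m: "marking (length bs) T"
    and h: "h [] = []" "\<And>xs ys. h (xs @ ys) = h xs @ h ys"
    and fixed: "\<And>e. e \<in> set (ends (concat T)) \<Longrightarrow> h [e] = [e]"
  shows "map h (fill bs T) = fill (map h bs) T"
proof -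
  have *: "h (fill_items bs xs) = fill_items (map h bs) xs"
    if "\<And>e. e \<in> set (ends xs) \<Longrightarrow> h [e] = [e]" "\<And>i. i \<in> set (item_slots xs) \<Longrightarrow> i < length bs"
    for xs
    using that
  proof (induction xs rule: item_slots.induct)
    case (2 e xs)
    then show ?case using h(2)[of "[e]" "fill_items bs xs"] by simp
  qed (simp_all add: h)
  have "h (fill_items bs xs) = fill_items (map h bs) xs" if xs: "xs \<in> set T" for xs
  proof (rule *)
    have "set (ends xs) \<subseteq> set (ends (concat T))"
      using xs by (induction T) auto
    then show "e \<in> set (ends xs) \<Longrightarrow> h [e] = [e]" for e
      using fixed by blast
    show "i \<in> set (item_slots xs) \<Longrightarrow> i < length bs" for i
      using xs marking_less[OF m] by (auto simp: slots_eq set_item_slots_concat)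
  qed
  then show ?thesis by (simp add: fill_eq)
qed

lemma rename_fill:
  assumes "marking (length bs) T" "\<And>a t s. (a, t, s) \<in> set (ends (concat T)) \<Longrightarrow> \<pi> a = a"
  shows "rename \<pi> (fill bs T) = fill (map (map (\<lambda>(a, t, s). (\<pi> a, t, s))) bs) T"
  unfolding rename_def by (rule map_fill) (use assms in auto)

lemma delete_arrows_fill:
  assumes "marking (length bs) T" "X \<inter> fst ` set (ends (concat T)) = {}"
  shows "delete_arrows X (fill bs T) = fill (map (filter (\<lambda>(a, t, s). a \<notin> X)) bs) T"
  unfolding delete_arrows_def by (rule map_fill) (use assms in force)+

section \<open>Triangle moves for all orientations of the strands\<close>

definition oriented :: "bool \<Rightarrow> 'a list \<Rightarrow> 'a list" where
  "oriented r xs = (if r then rev xs else xs)"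

lemma mset_oriented [simp]: "mset (oriented r xs) = mset xs"
  by (simp add: oriented_def)

lemma oriented_Not: "oriented (\<not> r) xs = oriented r (rev xs)"
  by (simp add: oriented_def)

lemma map_oriented: "map f (oriented r xs) = oriented r (map f xs)"
  by (simp add: oriented_def rev_map)

lemma filter_oriented: "filter P (oriented r xs) = oriented r (filter P xs)"
  by (simp add: oriented_def rev_filter)

text \<open>
  Let \<open>x\<close> run from the first to the second segment. A triangle move for \<open>x\<close> of sign \<open>s\<close> implies the
  one for the opposite sign and the opposite position of \<open>x\<close> on both segments. For
  \<open>p = q = False\<close> the blocks of tails pass through
  \<open>y\<^sub>1 x \<rightarrow> w v y\<^sub>1 x \<rightarrow> w y\<^sub>1 v x \<rightarrow> w y\<^sub>1\<close>, where \<open>v\<close> has sign \<open>s\<close>, while \<open>w\<close> and \<open>x\<close> have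
  sign \<open>- s\<close>, and \<open>w\<close> is finally renamed to \<open>x\<close>. The outer steps are RII moves, the middle
  one is the given triangle move. The blocks of heads change in the same way.
\<close>

lemma interchangeable_switch_arrow:
  assumes other: "\<And>v. interchangeable k
      [oriented p [(v, Tail, s), y1], oriented q [(v, Head, s), y2], zs]
      [oriented (\<not> p) [(v, Tail, s), y1], oriented (\<not> q) [(v, Head, s), y2], zs']"
  shows "interchangeable k
      [oriented (\<not> p) [(x, Tail, - s), y1], oriented (\<not> q) [(x, Head, - s), y2], zs]
      [oriented p [(x, Tail, - s), y1], oriented q [(x, Head, - s), y2], zs']"
    (is "interchangeable k ?A0 ?A4")
  unfolding interchangeable_def
proof (intro conjI allI impI)
  fix T
  assume asm: "marking (length ?A0) T \<and> gauss_diagram k (fill ?A0 T) \<and> gauss_diagram k (fill ?A4 T)"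
  let ?E = "ends (concat T)"
  \<comment> \<open>Both new names have to avoid the whole diagram, before and after the move.\<close>
  define N where "N = fst ` set (y1 # y2 # zs @ zs' @ ?E)"
  have N: "finite N" "finite (insert x N)" by (simp_all add: N_def)
  obtain v where v: "v \<notin> insert x N" using ex_new_if_finite[OF _ N(2)] infinite_UNIV_nat by blast
  obtain w where w: "w \<notin> insert v (insert x N)"
    using ex_new_if_finite[OF infinite_UNIV_nat, of "insert v (insert x N)"] N by auto
  have m: "marking 3 T" using asm by (simp add: numeral_3_eq_3)
  have mark: "marking (length [a, b, c]) T" for a b c :: "endpoint list"
    using m by (simp add: numeral_3_eq_3)
  have d0: "gauss_diagram k (fill ?A0 T)" and d4: "gauss_diagram k (fill ?A4 T)"
    using asm by simp_all
  have len: "length T = k"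
    using d0 by (simp only: gauss_fill[OF mark])
  have g0: "paired ([(x, Tail, - s), (x, Head, - s)] @ y1 # y2 # zs @ ?E)"
    using d0 by (simp only: gauss_fill[OF mark]) (elim conjE, erule paired_cong[rotated], simp)
  have g4: "paired ([(x, Tail, - s), (x, Head, - s)] @ y1 # y2 # zs' @ ?E)"
    using d4 by (simp only: gauss_fill[OF mark]) (elim conjE, erule paired_cong[rotated], simp)
  have s: "s \<in> {1, -1}" "- s \<in> {1, -1}"
    using g0 by (auto simp: paired_add_arrow)
  let ?A1 = "[oriented p [(w, Tail, - s), (v, Tail, s), y1, (x, Tail, - s)],
              oriented q [(w, Head, - s), (v, Head, s), y2, (x, Head, - s)], zs]"
  let ?A2 = "[oriented p [(w, Tail, - s), y1, (v, Tail, s), (x, Tail, - s)],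
              oriented q [(w, Head, - s), y2, (v, Head, s), (x, Head, - s)], zs']"
  let ?A3 = "[oriented p [(w, Tail, - s), y1], oriented q [(w, Head, - s), y2], zs']"
  have g1: "paired ([(w, Tail, - s), (w, Head, - s)] @ [(v, Tail, s), (v, Head, s)] @
      [(x, Tail, - s), (x, Head, - s)] @ y1 # y2 # zs @ ?E)"
    using v w g0 s by (simp add: paired_add_arrow N_def image_Un)
  have g2: "paired ([(w, Tail, - s), (w, Head, - s)] @ [(v, Tail, s), (v, Head, s)] @
      [(x, Tail, - s), (x, Head, - s)] @ y1 # y2 # zs' @ ?E)"
    using v w g4 s by (simp add: paired_add_arrow N_def image_Un)
  have g3: "paired ([(w, Tail, - s), (w, Head, - s)] @ y1 # y2 # zs' @ ?E)"
    using w g4 s by (simp add: paired_add_arrow N_def image_Un)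
  have d1: "gauss_diagram k (fill ?A1 T)"
    using g1 len by (simp only: gauss_fill[OF mark] simp_thms) (erule paired_cong[rotated], simp)
  have d2: "gauss_diagram k (fill ?A2 T)"
    using g2 len by (simp only: gauss_fill[OF mark] simp_thms) (erule paired_cong[rotated], simp)
  have d3: "gauss_diagram k (fill ?A3 T)"
    using g3 len by (simp only: gauss_fill[OF mark] simp_thms) (erule paired_cong[rotated], simp)
  have "interchangeable k [[], []]
      [oriented p [(w, Tail, - s), (v, Tail, s)], oriented q [(w, Head, - s), (v, Head, s)]]"
    by (rule interchangeable_RII[of _ v s w]) (simp_all add: oriented_def)
  from interchangeable_refine[OF this, of "[oriented p [Slot 0, End y1, End (x, Tail, - s)],
        oriented q [Slot 1, End y2, End (x, Head, - s)], map End zs]"]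
  have "interchangeable k ?A0 ?A1"
    by (cases p; cases q) (simp_all add: oriented_def upt_rec)
  then have e1: "(fill ?A0 T, fill ?A1 T) \<in> gauss_equiv k"
    using mark d0 d1 by (rule interchangeable_fill)
  from interchangeable_refine[OF other, of "[oriented p [End (w, Tail, - s), Slot 0, End (x, Tail, - s)],
        oriented q [End (w, Head, - s), Slot 1, End (x, Head, - s)], [Slot 2]]" v]
  have "interchangeable k ?A1 ?A2"
    by (cases p; cases q) (simp_all add: oriented_def upt_rec)
  then have e2: "(fill ?A1 T, fill ?A2 T) \<in> gauss_equiv k"
    using mark d1 d2 by (rule interchangeable_fill)
  have "interchangeable k [[], []]
      [oriented p [(v, Tail, s), (x, Tail, - s)], oriented q [(v, Head, s), (x, Head, - s)]]"
    by (rule interchangeable_RII[of _ v s x]) (simp_all add: oriented_def)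
  from interchangeable_refine[OF this, of "[oriented p [End (w, Tail, - s), End y1, Slot 0],
        oriented q [End (w, Head, - s), End y2, Slot 1], map End zs']"]
  have "interchangeable k ?A3 ?A2"
    by (cases p; cases q) (simp_all add: oriented_def upt_rec)
  then have e3: "(fill ?A3 T, fill ?A2 T) \<in> gauss_equiv k"
    using mark d3 d2 by (rule interchangeable_fill)
  \<comment> \<open>The swap of the two names is injective, and only one of them occurs before renaming.\<close>
  define \<pi> where "\<pi> a = (if a = w then x else if a = x then w else a)" for a
  have "inj \<pi>" by (auto simp: inj_def \<pi>_def)
  have xN: "x \<notin> fst ` set (y1 # y2 # zs' @ ?E)"
    using g4 by (simp add: paired_add_arrow)
  have fix_other: "(\<lambda>(a, t, s). (\<pi> a, t, s)) e = e" if "e \<in> set (y1 # y2 # zs' @ ?E)" for e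
  proof -
    have "fst e \<in> fst ` set (y1 # y2 # zs' @ ?E)" using that by (rule imageI)
    moreover from this have "fst e \<noteq> w" using w by (auto simp: N_def)
    ultimately show ?thesis using xN by (cases e) (auto simp: \<pi>_def)
  qed
  have "\<pi> a = a" if "(a, t, r) \<in> set ?E" for a t r
    using fix_other[of "(a, t, r)"] that by simp
  then have "rename \<pi> (fill ?A3 T) = fill (map (map (\<lambda>(a, t, s). (\<pi> a, t, s))) ?A3) T"
    using mark by (intro rename_fill) simp_all
  moreover have "map (map (\<lambda>(a, t, s). (\<pi> a, t, s))) ?A3 = ?A4"
  proof -
    have "map (\<lambda>(a, t, s). (\<pi> a, t, s)) zs' = zs'"
      using fix_other by (intro map_idI) simp
    moreover have "(\<lambda>(a, t, s). (\<pi> a, t, s)) y1 = y1" "(\<lambda>(a, t, s). (\<pi> a, t, s)) y2 = y2"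
      using fix_other by simp_all
    moreover have "\<pi> w = x" by (simp add: \<pi>_def)
    ultimately show ?thesis by (simp add: oriented_def)
  qed
  ultimately have "rename \<pi> (fill ?A3 T) = fill ?A4 T" by simp
  then have e4: "(fill ?A3 T, fill ?A4 T) \<in> gauss_equiv k"
    using gauss_equiv_rename[OF inj_on_subset[OF \<open>inj \<pi>\<close> subset_UNIV] d3] d4 by simp
  show "(fill ?A0 T, fill ?A4 T) \<in> gauss_equiv k"
    using e1 e2 e3 e4 by (blast intro: gauss_equiv_trans gauss_equiv_sym)
qed simp

text \<open>
  Three arrows from the first to the second, from the first to the third and from the second to
  the third segment. On each segment the boolean says whether the order is opposite to the one in
  the definition of RIII.
\<close>

definition triangle ::
  "bool \<Rightarrow> bool \<Rightarrow> bool \<Rightarrow> int \<Rightarrow> int \<Rightarrow> int \<Rightarrow> nat \<Rightarrow> nat \<Rightarrow> nat \<Rightarrow> endpoint list list" where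
  "triangle p q r sa sb sc a b c =
     [oriented p [(a, Tail, sa), (b, Tail, sb)], oriented q [(a, Head, sa), (c, Tail, sc)],
      oriented r [(b, Head, sb), (c, Head, sc)]]"

definition triangle_move :: "nat \<Rightarrow> bool \<Rightarrow> bool \<Rightarrow> bool \<Rightarrow> int \<Rightarrow> int \<Rightarrow> int \<Rightarrow> bool" where
  "triangle_move l p q r sa sb sc \<longleftrightarrow> (\<forall>a b c. interchangeable l
     (triangle p q r sa sb sc a b c) (triangle (\<not> p) (\<not> q) (\<not> r) sa sb sc a b c))"

lemma triangle_move_sym:
  "triangle_move l p q r sa sb sc \<Longrightarrow> triangle_move l (\<not> p) (\<not> q) (\<not> r) sa sb sc"
  by (simp add: triangle_move_def interchangeable_sym)

text \<open>
  The switching lemma speaks of the first two segments; relabelling the segments makes it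
  applicable to each of the three arrows.
\<close>

lemma interchangeable_permute:
  assumes "interchangeable k [x, y, z] [x', y', z']"
  shows "interchangeable k [x, z, y] [x', z', y']" "interchangeable k [y, z, x] [y', z', x']"
    "interchangeable k [z, x, y] [z', x', y']"
  using interchangeable_refine[OF assms, of "[[Slot 0], [Slot 2], [Slot 1]]"]
    interchangeable_refine[OF assms, of "[[Slot 1], [Slot 2], [Slot 0]]"]
    interchangeable_refine[OF assms, of "[[Slot 2], [Slot 0], [Slot 1]]"]
  by (simp_all add: upt_rec)

lemma oriented_swap: "oriented r [x, y] = oriented (\<not> r) [y, x]"
  by (simp add: oriented_def)

lemma triangle_move_switch_a:
  assumes "triangle_move l p q r sa sb sc"
  shows "triangle_move l (\<not> p) (\<not> q) r (- sa) sb sc"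
  using assms interchangeable_switch_arrow[of l p sa _ q]
  unfolding triangle_move_def triangle_def by simp

lemma triangle_move_switch_b:
  assumes "triangle_move l p q r sa sb sc"
  shows "triangle_move l (\<not> p) q (\<not> r) sa (- sb) sc"
  unfolding triangle_move_def
proof (intro allI)
  fix a b c
  have "interchangeable l
      [oriented (\<not> p) [(b, Tail, sb), (a, Tail, sa)], oriented r [(b, Head, sb), (c, Head, sc)],
       oriented q [(a, Head, sa), (c, Tail, sc)]]
      [oriented p [(b, Tail, sb), (a, Tail, sa)], oriented (\<not> r) [(b, Head, sb), (c, Head, sc)],
       oriented (\<not> q) [(a, Head, sa), (c, Tail, sc)]]" for b
    using assms interchangeable_permute(1) oriented_swap[of _ "(b, Tail, sb)" "(a, Tail, sa)"]
    by (simp add: triangle_move_def triangle_def)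
  then show "interchangeable l (triangle (\<not> p) q (\<not> r) sa (- sb) sc a b c)
      (triangle (\<not> \<not> p) (\<not> q) (\<not> \<not> r) sa (- sb) sc a b c)"
    using interchangeable_permute(1)[OF interchangeable_switch_arrow[of l "\<not> p" sb "(a, Tail, sa)" r
        "(c, Head, sc)" "oriented q [(a, Head, sa), (c, Tail, sc)]"
        "oriented (\<not> q) [(a, Head, sa), (c, Tail, sc)]" b]]
      oriented_swap[of _ "(b, Tail, - sb)" "(a, Tail, sa)"]
    by (simp add: triangle_def)
qed

lemma triangle_move_switch_c:
  assumes "triangle_move l p q r sa sb sc"
  shows "triangle_move l p (\<not> q) (\<not> r) sa sb (- sc)"
  unfolding triangle_move_def
proof (intro allI)
  fix a b c
  have "interchangeable l
      [oriented (\<not> q) [(c, Tail, sc), (a, Head, sa)], oriented (\<not> r) [(c, Head, sc), (b, Head, sb)],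
       oriented p [(a, Tail, sa), (b, Tail, sb)]]
      [oriented q [(c, Tail, sc), (a, Head, sa)], oriented r [(c, Head, sc), (b, Head, sb)],
       oriented (\<not> p) [(a, Tail, sa), (b, Tail, sb)]]" for c
    using assms interchangeable_permute(2) oriented_swap[of _ "(c, Tail, sc)" "(a, Head, sa)"]
      oriented_swap[of _ "(c, Head, sc)" "(b, Head, sb)"]
    by (simp add: triangle_move_def triangle_def)
  then show "interchangeable l (triangle p (\<not> q) (\<not> r) sa sb (- sc) a b c)
      (triangle (\<not> p) (\<not> \<not> q) (\<not> \<not> r) sa sb (- sc) a b c)"
    using interchangeable_permute(3)[OF interchangeable_switch_arrow[of l "\<not> q" sc "(a, Head, sa)" "\<not> r"
        "(b, Head, sb)" "oriented p [(a, Tail, sa), (b, Tail, sb)]"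
        "oriented (\<not> p) [(a, Tail, sa), (b, Tail, sb)]" c]]
      oriented_swap[of _ "(c, Tail, - sc)" "(a, Head, sa)"]
      oriented_swap[of _ "(c, Head, - sc)" "(b, Head, sb)"]
    by (simp add: triangle_def)
qed

text \<open>
  The factor by which the sign of an arrow changes when its two strands are embedded with
  orientations reversed as indicated.
\<close>

definition strand_sign :: "bool \<Rightarrow> bool \<Rightarrow> int" where
  "strand_sign p q = (if p \<noteq> q then - 1 else 1)"

text \<open>
  Up to symmetry of the move, reversing one strand is the same as switching the two arrows that
  end on it. For instance, switching \<open>a\<close> and \<open>b\<close> changes the order twice on the first segment and
  once on the other two, which is the reversal of the first segment read backwards. So the eight
  cases come from RIII itself and three pairs of switches.
\<close>

lemma triangle_move_oriented:
  "triangle_move l p q r (strand_sign p q) (strand_sign p r) (strand_sign q r)"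
proof -
  have 0: "triangle_move l False False False 1 1 1"
    using interchangeable_RIII[OF refl, of l _ 1]
    by (simp add: triangle_move_def triangle_def oriented_def)
  note a = triangle_move_switch_a and b = triangle_move_switch_b and c = triangle_move_switch_c
  show ?thesis
    using 0 triangle_move_sym[OF 0]
      b[OF a[OF 0]] triangle_move_sym[OF b[OF a[OF 0]]]
      c[OF a[OF 0]] triangle_move_sym[OF c[OF a[OF 0]]]
      c[OF b[OF 0]] triangle_move_sym[OF c[OF b[OF 0]]]
    by (cases p; cases q; cases r) (simp_all add: strand_sign_def)
qed

section \<open>Words with named letters\<close>

text \<open>
  A letter together with the name of its arrow. Names attached to letters, rather than to
  positions, survive inserting, deleting and exchanging letters.
\<close>

type_synonym named_word = "(nat \<times> nat \<times> nat \<times> int) list"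

fun letter_ends :: "(nat \<Rightarrow> bool) \<Rightarrow> nat \<Rightarrow> nat \<times> nat \<times> nat \<times> int \<Rightarrow> endpoint list" where
  "letter_ends \<rho> p (x, i, j, \<epsilon>) =
     (if p = i then [(x, Tail, strand_sign (\<rho> i) (\<rho> j) * \<epsilon>)]
      else if p = j then [(x, Head, strand_sign (\<rho> i) (\<rho> j) * \<epsilon>)] else [])"

definition strand_ends :: "(nat \<Rightarrow> bool) \<Rightarrow> named_word \<Rightarrow> nat \<Rightarrow> endpoint list" where
  "strand_ends \<rho> W p = concat (map (letter_ends \<rho> p) W)"

definition named :: "(nat \<Rightarrow> nat) \<Rightarrow> pv_word \<Rightarrow> named_word" where
  "named lab w = map (\<lambda>l. (lab l, w ! l)) [0..<length w]"

lemma strand_ends_simps [simp]: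
  "strand_ends \<rho> [] p = []"
  "strand_ends \<rho> (L # W) p = letter_ends \<rho> p L @ strand_ends \<rho> W p"
  "strand_ends \<rho> (V @ W) p = strand_ends \<rho> V p @ strand_ends \<rho> W p"
  by (simp_all add: strand_ends_def)

lemma word_of_named [simp]: "map snd (named lab w) = w"
  by (simp add: named_def comp_def map_nth)

lemma strand_block_named: "strand_block w lab \<rho> p = oriented (\<rho> p) (strand_ends \<rho> (named lab w) p)"
proof -
  have "(\<lambda>l. case w ! l of (i, j, \<epsilon>) \<Rightarrow>
            let s = (if \<rho> i \<noteq> \<rho> j then - \<epsilon> else \<epsilon>) in
            if p = i then [(lab l, Tail, s)] else if p = j then [(lab l, Head, s)] else []) =
        (\<lambda>l. letter_ends \<rho> p (lab l, w ! l))"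
    by (auto simp: fun_eq_iff strand_sign_def Let_def split: prod.splits)
  then show ?thesis
    by (simp add: strand_block_def oriented_def strand_ends_def named_def comp_def)
qed

definition arrow_ends :: "(nat \<Rightarrow> bool) \<Rightarrow> named_word \<Rightarrow> endpoint list" where
  "arrow_ends \<rho> W = concat (map (\<lambda>(x, i, j, \<epsilon>).
     [(x, Tail, strand_sign (\<rho> i) (\<rho> j) * \<epsilon>), (x, Head, strand_sign (\<rho> i) (\<rho> j) * \<epsilon>)]) W)"

lemma arrow_ends_simps [simp]:
  "arrow_ends \<rho> [] = []"
  "arrow_ends \<rho> ((x, i, j, \<epsilon>) # W) = (x, Tail, strand_sign (\<rho> i) (\<rho> j) * \<epsilon>) #
     (x, Head, strand_sign (\<rho> i) (\<rho> j) * \<epsilon>) # arrow_ends \<rho> W"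
  by (simp_all add: arrow_ends_def)

lemma mset_concat_upt: "mset (concat (map f [0..<m])) = (\<Sum>p<m. mset (f p))"
  by (induction m) auto

lemma pv_words_Cons:
  "(i, j, \<epsilon>) # w \<in> pv_words m \<longleftrightarrow>
     i < m \<and> j < m \<and> i \<noteq> j \<and> \<epsilon> \<in> {1, -1} \<and> w \<in> pv_words m"
  by (auto simp: pv_words_def)

lemma mset_strand_ends:
  assumes "map snd W \<in> pv_words m"
  shows "(\<Sum>p<m. mset (strand_ends \<rho> W p)) = mset (arrow_ends \<rho> W)"
  using assms
proof (induction W)
  case (Cons L W)
  obtain x i j \<epsilon> where L: "L = (x, i, j, \<epsilon>)" by (cases L)
  let ?s = "strand_sign (\<rho> i) (\<rho> j) * \<epsilon>"
  have ij: "i < m" "j < m" "i \<noteq> j" and W: "map snd W \<in> pv_words m"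
    using Cons.prems by (simp_all add: L pv_words_Cons)
  have "(\<Sum>p<m. mset (letter_ends \<rho> p L)) =
      (\<Sum>p<m. (if p = i then {#(x, Tail, ?s)#} else {#}) + (if p = j then {#(x, Head, ?s)#} else {#}))"
    using ij by (intro sum.cong) (auto simp: L)
  also have "\<dots> = {#(x, Tail, ?s), (x, Head, ?s)#}"
    using ij by (simp add: sum.distrib)
  finally show ?case
    using Cons.IH[OF W] by (simp add: sum.distrib L)
qed simp

lemma names_arrow_ends: "fst ` set (arrow_ends \<rho> W) = fst ` set W"
proof (induction W)
  case (Cons L W)
  then show ?case by (cases L) simp
qed simp

text \<open>
  Each letter of a word contributes one arrow, so attaching gives a Gauss diagram exactly when the
  names are new and pairwise distinct.
\<close>

lemma paired_arrow_ends:
  assumes "map snd W \<in> pv_words m"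
  shows "paired (arrow_ends \<rho> W @ es) \<longleftrightarrow>
    paired es \<and> distinct (map fst W) \<and> fst ` set W \<inter> fst ` set es = {}"
  using assms
proof (induction W)
  case (Cons L W)
  obtain x i j \<epsilon> where L: "L = (x, i, j, \<epsilon>)" by (cases L)
  let ?s = "strand_sign (\<rho> i) (\<rho> j) * \<epsilon>"
  have "?s \<in> {1, -1}" and W: "map snd W \<in> pv_words m"
    using Cons.prems by (auto simp: L pv_words_Cons strand_sign_def)
  moreover have "arrow_ends \<rho> (L # W) = (x, Tail, ?s) # (x, Head, ?s) # arrow_ends \<rho> W"
    by (simp add: L)
  ultimately show ?case
    using Cons.IH[OF W] by (auto simp: paired_add_arrow image_Un names_arrow_ends L)
qed simp

section \<open>Attaching words\<close>

locale marked_diagram =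
  fixes k m :: nat and \<rho> :: "nat \<Rightarrow> bool" and T :: marked_code
  assumes marking: "marking m T"
    and gauss_unmark: "gauss_diagram k (unmark m T)"
begin

abbreviation names :: "nat set" where
  "names \<equiv> fst ` set (ends (concat T))"

definition fresh :: "named_word \<Rightarrow> bool" where
  "fresh W \<longleftrightarrow> distinct (map fst W) \<and> fst ` set W \<inter> names = {}"

definition attached :: "named_word \<Rightarrow> gauss_code" where
  "attached W = fill (map (\<lambda>p. oriented (\<rho> p) (strand_ends \<rho> W p)) [0..<m]) T"

lemma attach_named: "attach m w lab \<rho> T = attached (named lab w)"
  unfolding attach_def attached_def by (simp add: strand_block_named cong: map_cong)

lemma attached_Nil: "attached [] = unmark m T"
proof -
  have "map (\<lambda>p. oriented (\<rho> p) (strand_ends \<rho> [] p)) [0..<m] = replicate m []"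
    by (simp add: oriented_def map_replicate_const cong: if_cong)
  then show ?thesis by (simp add: attached_def unmark_def)
qed

lemma mset_attached:
  assumes "map snd W \<in> pv_words m"
  shows "mset (concat (attached W)) = mset (arrow_ends \<rho> W @ ends (concat T))"
  using marking mset_strand_ends[OF assms, of \<rho>]
  by (simp add: attached_def mset_fill mset_concat_upt)

lemma gauss_attached_iff:
  assumes "map snd W \<in> pv_words m"
  shows "gauss_diagram k (attached W) \<longleftrightarrow>
    length T = k \<and> paired (ends (concat T)) \<and> fresh W"
  using paired_arrow_ends[OF assms] paired_mset[OF mset_attached[OF assms]]
  by (simp add: gauss_diagram_paired fresh_def) (simp add: attached_def)

lemma gauss_attached:
  assumes "map snd W \<in> pv_words m"
  shows "gauss_diagram k (attached W) \<longleftrightarrow> fresh W"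
  using gauss_attached_iff[OF assms] gauss_attached_iff[of "[]"] gauss_unmark
  by (simp add: attached_Nil)

lemma arrows_attached:
  assumes "map snd W \<in> pv_words m"
  shows "arrows (attached W) = fst ` set W \<union> names"
  using mset_eq_setD[OF mset_attached[OF assms]]
  by (simp add: arrows_eq image_Un names_arrow_ends del: set_concat)

lemma ex_map_eq:
  assumes "distinct xs" "length xs = length ys"
  shows "\<exists>f. map f xs = ys"
  using assms(2,1)
proof (induction xs ys rule: list_induct2)
  case (Cons x xs y ys)
  then obtain f where "map f xs = ys" by auto
  with Cons.prems have "map (f(x := y)) (x # xs) = y # ys" by auto
  then show ?case by (intro exI[of _ "f(x := y)"])
qed simp

lemma attached_names_irrelevant:
  assumes "map snd W = map snd W'" "map snd W \<in> pv_words m" "fresh W" "fresh W'"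
  shows "(attached W, attached W') \<in> gauss_equiv k"
proof -
  have len: "length (map fst W) = length (map fst W')"
    using assms(1) by (metis length_map)
  obtain f where f: "map f (map fst W) = map fst W'"
    using ex_map_eq[OF _ len] assms(3) unfolding fresh_def by blast
  \<comment> \<open>The renaming has to fix the names of the arrows that are already in the diagram.\<close>
  define \<pi> where "\<pi> a = (if a \<in> names then a else f a)" for a
  have \<pi>_names: "\<pi> a = a" if "a \<in> names" for a
    using that by (simp add: \<pi>_def)
  have \<pi>_W: "map \<pi> (map fst W) = map fst W'"
    unfolding f[symmetric] using assms(3) by (intro map_cong) (auto simp: \<pi>_def fresh_def)
  have W': "W' = map (\<lambda>(x, l). (\<pi> x, l)) W"
  proof (rule pair_list_eqI)
    show "map fst W' = map fst (map (\<lambda>(x, l). (\<pi> x, l)) W)"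
      unfolding \<pi>_W[symmetric] by (simp add: split_def)
    show "map snd W' = map snd (map (\<lambda>(x, l). (\<pi> x, l)) W)"
      unfolding assms(1)[symmetric] by (simp add: split_def)
  qed
  have inj: "inj_on \<pi> (fst ` set W \<union> names)"
  proof -
    have "inj_on \<pi> (fst ` set W)"
      using assms(4) distinct_map[of \<pi> "map fst W"] unfolding fresh_def \<pi>_W by simp
    moreover have "\<pi> ` fst ` set W = fst ` set W'"
      using \<pi>_W by (metis list.set_map)
    moreover have "inj_on \<pi> names" "\<pi> ` names = names"
      using \<pi>_names by (simp_all add: inj_on_def)
    moreover have "fst ` set W' \<inter> names = {}"
      using assms(4) by (simp add: fresh_def)
    ultimately show ?thesis
      unfolding inj_on_Un by blast
  qed
  let ?r = "map (\<lambda>(a, t, s). (\<pi> a, t, s))"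
  have "?r (strand_ends \<rho> W p) = strand_ends \<rho> W' p" for p
    unfolding W' by (induction W) auto
  then have "map ?r (map (\<lambda>p. oriented (\<rho> p) (strand_ends \<rho> W p)) [0..<m]) =
      map (\<lambda>p. oriented (\<rho> p) (strand_ends \<rho> W' p)) [0..<m]"
    by (simp only: map_map comp_def map_oriented)
  moreover have "rename \<pi> (attached W) =
      fill (map ?r (map (\<lambda>p. oriented (\<rho> p) (strand_ends \<rho> W p)) [0..<m])) T"
    unfolding attached_def
  proof (rule rename_fill)
    show "(a, t, s) \<in> set (ends (concat T)) \<Longrightarrow> \<pi> a = a" for a t s
      by (rule \<pi>_names) (erule rev_image_eqI, simp)
  qed (simp add: marking)
  ultimately have "rename \<pi> (attached W) = attached W'"
    by (simp only: attached_def)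
  then show ?thesis
    using gauss_equiv_rename[of \<pi> "attached W" k] inj assms(3,4)
      gauss_attached[OF assms(2)] gauss_attached[of W'] arrows_attached[OF assms(2)] assms(1,2)
    by simp
qed

lemma delete_arrows_attached:
  assumes "fresh (U @ L # V)"
  shows "delete_arrows {fst L} (attached (U @ L # V)) = attached (U @ V)"
proof -
  let ?f = "filter (\<lambda>(a, t, s). a \<notin> {fst L})"
  have other: "?f (strand_ends \<rho> W p) = strand_ends \<rho> W p" if "fst L \<notin> fst ` set W" for W p
    using that by (induction W) (auto simp: split_def)
  have "?f (letter_ends \<rho> p L) = []" for p
    by (cases L) auto
  then have "?f (strand_ends \<rho> (U @ L # V) p) = strand_ends \<rho> (U @ V) p" for p
    using assms other[of U p] other[of V p] by (simp add: fresh_def del: singleton_iff)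
  then have "map ?f (map (\<lambda>p. oriented (\<rho> p) (strand_ends \<rho> (U @ L # V) p)) [0..<m]) =
      map (\<lambda>p. oriented (\<rho> p) (strand_ends \<rho> (U @ V) p)) [0..<m]"
    by (simp only: map_map comp_def filter_oriented)
  moreover have "delete_arrows {fst L} (attached (U @ L # V)) =
      fill (map ?f (map (\<lambda>p. oriented (\<rho> p) (strand_ends \<rho> (U @ L # V) p)) [0..<m])) T"
    unfolding attached_def
    by (rule delete_arrows_fill) (use marking assms in \<open>simp_all add: fresh_def\<close>)
  ultimately show ?thesis by (simp only: attached_def)
qed

text \<open>
  Replacing a subword affects only the strands \<open>ps\<close> that it involves. On each of them it
  occupies one segment between the contributions of the rest of the word, so that the comparison
  reduces to the blocks of the two subwords alone.
\<close>

lemma attached_subword: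
  assumes ps: "distinct ps" "set ps \<subseteq> {..<m}"
    and M: "\<And>p. p \<notin> set ps \<Longrightarrow> strand_ends \<rho> M p = []"
    and M': "\<And>p. p \<notin> set ps \<Longrightarrow> strand_ends \<rho> M' p = []"
    and inter: "interchangeable k (map (\<lambda>p. oriented (\<rho> p) (strand_ends \<rho> M p)) ps)
      (map (\<lambda>p. oriented (\<rho> p) (strand_ends \<rho> M' p)) ps)"
    and gauss: "gauss_diagram k (attached (U @ M @ V))" "gauss_diagram k (attached (U @ M' @ V))"
  shows "(attached (U @ M @ V), attached (U @ M' @ V)) \<in> gauss_equiv k"
proof -
  obtain pos where pos: "map pos ps = [0..<length ps]"
    using ex_map_eq[OF ps(1), of "[0..<length ps]"] unfolding length_upt diff_zero by blast
  have pos_less: "pos p < length ps" and nth_pos: "ps ! pos p = p" if "p \<in> set ps" for p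
  proof -
    have "\<exists>t<length ps. ps ! t = p" using that by (simp add: in_set_conv_nth)
    then obtain t where t: "t < length ps" "p = ps ! t" by blast
    then have "pos p = t" using nth_map[of t ps pos] by (simp add: pos)
    then show "pos p < length ps" "ps ! pos p = p" using t by simp_all
  qed
  \<comment> \<open>The pattern on a strand, with a segment left open where the subword goes.\<close>
  define B where "B p = oriented (\<rho> p) (map End (strand_ends \<rho> U p) @
    (if p \<in> set ps then [Slot (pos p)] else []) @ map End (strand_ends \<rho> V p))" for p
  have fill_B: "map (fill_items (map (\<lambda>p. oriented (\<rho> p) (strand_ends \<rho> W p)) ps)) (map B [0..<m]) =
      map (\<lambda>p. oriented (\<rho> p) (strand_ends \<rho> (U @ W @ V) p)) [0..<m]"
    if W: "\<And>p. p \<notin> set ps \<Longrightarrow> strand_ends \<rho> W p = []" for W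
  proof -
    have "fill_items (map (\<lambda>p. oriented (\<rho> p) (strand_ends \<rho> W p)) ps) (B p) =
        oriented (\<rho> p) (strand_ends \<rho> (U @ W @ V) p)" for p
      using pos_less[of p] nth_pos[of p] W[of p]
      by (cases "p \<in> set ps"; cases "\<rho> p") (simp_all add: B_def oriented_def rev_map)
    then show ?thesis by (simp only: map_map comp_def)
  qed
  have "mset (item_slots (concat (map B [0..<m]))) = (\<Sum>p<m. mset (item_slots (B p)))"
    using mset_concat_upt[of "\<lambda>p. item_slots (B p)" m] by (simp add: item_slots_concat comp_def)
  also have "\<dots> = (\<Sum>p<m. if p \<in> set ps then {#pos p#} else {#})"
    by (intro sum.cong) (auto simp: B_def oriented_def rev_map)
  also have "\<dots> = (\<Sum>p\<in>set ps. {#pos p#})"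
    using ps(2) by (simp add: sum.If_cases Int_absorb1)
  also have "\<dots> = mset (map pos ps)"
    using ps(1) by (induction ps) auto
  finally have "mset (item_slots (concat (map B [0..<m]))) = mset [0..<length ps]"
    by (simp add: pos)
  then have "interchangeable k (map (\<lambda>p. oriented (\<rho> p) (strand_ends \<rho> (U @ M @ V) p)) [0..<m])
      (map (\<lambda>p. oriented (\<rho> p) (strand_ends \<rho> (U @ M' @ V) p)) [0..<m])"
    using interchangeable_refine[OF inter, of "map B [0..<m]"] fill_B[of M] fill_B[of M'] M M'
    by (simp only: length_map simp_thms)
  from interchangeable_fill[OF this] show ?thesis
    using marking gauss by (simp add: attached_def)
qed

text \<open>
  Both letters have the same two strands and opposite signs, also after reversals, so their
  arrows form an RII pair.
\<close>

lemma attached_cancel: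
  assumes "map snd (U @ [(x, i, j, \<epsilon>), (y, i, j, - \<epsilon>)] @ V) \<in> pv_words m"
    and "fresh (U @ [(x, i, j, \<epsilon>), (y, i, j, - \<epsilon>)] @ V)"
  shows "(attached (U @ [(x, i, j, \<epsilon>), (y, i, j, - \<epsilon>)] @ V), attached (U @ V)) \<in> gauss_equiv k"
proof -
  let ?M = "[(x, i, j, \<epsilon>), (y, i, j, - \<epsilon>)]"
  let ?s = "strand_sign (\<rho> i) (\<rho> j) * \<epsilon>"
  have ij: "i < m" "j < m" "i \<noteq> j" and UV: "map snd (U @ V) \<in> pv_words m"
    using assms(1) by (simp_all add: pv_words_Cons)
  have "fresh (U @ V)" using assms(2) by (auto simp: fresh_def)
  then have g: "gauss_diagram k (attached (U @ [] @ V))"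
    using gauss_attached[OF UV] by simp
  have "interchangeable k [[], []] [oriented (\<rho> i) [(x, Tail, ?s), (y, Tail, - ?s)],
      oriented (\<rho> j) [(x, Head, ?s), (y, Head, - ?s)]]"
    by (rule interchangeable_RII[of _ x ?s y]) (simp_all add: oriented_def)
  moreover have "oriented r ([] :: endpoint list) = []" for r
    by (simp add: oriented_def)
  ultimately have "interchangeable k (map (\<lambda>p. oriented (\<rho> p) (strand_ends \<rho> [] p)) [i, j])
     (map (\<lambda>p. oriented (\<rho> p) (strand_ends \<rho> ?M p)) [i, j])"
    using ij by simp
  from attached_subword[OF _ _ _ _ interchangeable_sym[OF this], of U V] show ?thesis
    using ij g gauss_attached[OF assms(1)] assms(2) by simp
qed

text \<open>
  The three arrows form a triangle in which reversed strands account for all reversed orders and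
  negative signs, as in \<open>triangle_move_oriented\<close>.
\<close>

lemma attached_triple:
  fixes a b c i j l :: nat
  defines "M \<equiv> [(a, i, j, 1), (b, i, l, 1), (c, j, l, 1)]"
  assumes "distinct [i, j, l]" "map snd (U @ M @ V) \<in> pv_words m" "fresh (U @ M @ V)"
  shows "(attached (U @ M @ V), attached (U @ rev M @ V)) \<in> gauss_equiv k"
proof -
  have ijl: "i < m" "j < m" "l < m" "i \<noteq> j" "i \<noteq> l" "j \<noteq> l"
    and w': "map snd (U @ rev M @ V) \<in> pv_words m"
    using assms by (simp_all add: M_def pv_words_Cons)
  have "fresh (U @ rev M @ V)"
    using assms(4) by (auto simp: fresh_def M_def)
  moreover have "interchangeable k (map (\<lambda>p. oriented (\<rho> p) (strand_ends \<rho> M p)) [i, j, l])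
     (map (\<lambda>p. oriented (\<rho> p) (strand_ends \<rho> (rev M) p)) [i, j, l])"
    using triangle_move_oriented[of k "\<rho> i" "\<rho> j" "\<rho> l"] ijl
    by (simp add: triangle_move_def triangle_def M_def oriented_Not)
  ultimately show ?thesis
    using ijl gauss_attached[OF assms(3)] gauss_attached[OF w'] assms(4)
    by (intro attached_subword[of "[i, j, l]"]) (auto simp: M_def)
qed

text \<open>
  Letters on disjoint pairs of strands share no segment, so their order leaves no trace in the
  diagram.
\<close>

lemma attached_commute:
  assumes "distinct [i, j, l, p]"
  shows "attached (U @ [(x, i, j, 1), (y, l, p, 1)] @ V) = attached (U @ [(y, l, p, 1), (x, i, j, 1)] @ V)"
proof -
  have "strand_ends \<rho> [(x, i, j, 1), (y, l, p, 1)] q = strand_ends \<rho> [(y, l, p, 1), (x, i, j, 1)] q" for q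
    using assms by auto
  then have "strand_ends \<rho> (U @ [(x, i, j, 1), (y, l, p, 1)] @ V) q =
      strand_ends \<rho> (U @ [(y, l, p, 1), (x, i, j, 1)] @ V) q" for q
    by (simp only: strand_ends_simps(3))
  then show ?thesis by (simp only: attached_def)
qed

lemma attached_pv_step:
  assumes "pv_step w w'" "w \<in> pv_words m" "w' \<in> pv_words m" "map snd W = w" "fresh W"
  shows "\<exists>W'. map snd W' = w' \<and> fresh W' \<and> (attached W, attached W') \<in> gauss_equiv k"
  using assms(1)
proof cases
  case (cancel u i j \<epsilon> v)
  obtain U x y V where W: "W = U @ [(x, i, j, \<epsilon>), (y, i, j, - \<epsilon>)] @ V" "map snd U = u" "map snd V = v"
    using assms(4) unfolding cancel by (auto simp: map_eq_append_conv map_eq_Cons_conv)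
  have "fresh (U @ V)" using assms(5) by (auto simp: W fresh_def)
  then show ?thesis
    using attached_cancel[of U x i j \<epsilon> y V] assms(2,4,5) W cancel by (intro exI[of _ "U @ V"]) simp
next
  case (triple i j l u v)
  obtain U a b c V where W: "W = U @ [(a, i, j, 1), (b, i, l, 1), (c, j, l, 1)] @ V"
    "map snd U = u" "map snd V = v"
    using assms(4) unfolding triple by (auto simp: map_eq_append_conv map_eq_Cons_conv)
  let ?W = "U @ [(c, j, l, 1), (b, i, l, 1), (a, i, j, 1)] @ V"
  have "fresh ?W" using assms(5) by (auto simp: W fresh_def)
  then show ?thesis
    using attached_triple[of i j l U a b c V] assms(2,4,5) W triple by (intro exI[of _ ?W]) simp
next
  case (commute i j l p u v)
  obtain U x y V where W: "W = U @ [(x, i, j, 1), (y, l, p, 1)] @ V" "map snd U = u" "map snd V = v"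
    using assms(4) unfolding commute by (auto simp: map_eq_append_conv map_eq_Cons_conv)
  let ?W = "U @ [(y, l, p, 1), (x, i, j, 1)] @ V"
  have "fresh ?W" using assms(5) by (auto simp: W fresh_def)
  moreover have "attached ?W = attached W"
    unfolding W(1) using attached_commute commute(3) by simp
  ultimately show ?thesis
    using gauss_attached[of W] assms(2,4,5) W commute
    by (intro exI[of _ ?W]) (auto intro!: gauss_equiv_refl)
qed

text \<open>
  Any naming by new names would do, by \<open>attached_names_irrelevant\<close>; this one lies above all names of
  the diagram. The \<open>0\<close> only makes the maximum exist when the diagram has no arrows.
\<close>

definition new_name :: "nat \<Rightarrow> nat" where
  "new_name l = l + Suc (Max (insert 0 names))"

definition attached_class :: "pv_word \<Rightarrow> vlink" where
  "attached_class w = link_class k (attached (named new_name w))"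

lemma fresh_named: "fresh (named new_name w)"
proof -
  have "a < new_name l" if "a \<in> names" for a l
  proof -
    have "a \<le> Max (insert 0 names)"
      by (rule Max_ge) (use that in simp_all)
    moreover have "b < l + Suc b" for b by simp
    ultimately show ?thesis unfolding new_name_def by (rule le_less_trans)
  qed
  then have range: "range new_name \<inter> names = {}"
    by (intro equals0I) (elim IntE rangeE, force)
  have "fst ` set (named new_name w) \<subseteq> range new_name"
    unfolding named_def by auto
  then have "fst ` set (named new_name w) \<inter> names \<subseteq> range new_name \<inter> names"
    by (rule Int_mono[OF _ order_refl])
  moreover have "map fst (named new_name w) = map new_name [0..<length w]"
    by (simp add: named_def)
  then have "distinct (map fst (named new_name w))"
    by (simp only: distinct_map) (simp add: inj_on_def new_name_def)
  ultimately show ?thesis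
    unfolding fresh_def range subset_empty by (intro conjI)
qed

lemma link_class_attached:
  assumes "map snd W \<in> pv_words m" "fresh W"
  shows "link_class k (attached W) = attached_class (map snd W)"
  unfolding attached_class_def
  using assms by (intro link_class_eq attached_names_irrelevant fresh_named) simp_all

text \<open>
  The link obtained by attaching depends on the element of the pure virtual braid group only.
\<close>

lemma attached_class_equiv:
  assumes "(w, w') \<in> pv_equiv m"
  shows "attached_class w = attached_class w'"
proof -
  let ?R = "\<lambda>w w'. w \<in> pv_words m \<and> w' \<in> pv_words m \<and> pv_step w w'"
  have step_eq: "attached_class w = attached_class w'" if w: "?R w w'" for w w'
  proof -
    let ?W = "named new_name w"
    obtain W' where W': "map snd W' = w'" "fresh W'" "(attached ?W, attached W') \<in> gauss_equiv k"
      using attached_pv_step[of w w' ?W] w fresh_named by auto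
    have "attached_class w = link_class k (attached W')"
      unfolding attached_class_def using W'(3) by (rule link_class_eq)
    then show ?thesis using link_class_attached[of W'] W' w by simp
  qed
  have "equivclp ?R w w'" using assms by (simp add: pv_equiv_def)
  then show ?thesis
  proof (induction rule: equivclp_induct)
    case (step y z)
    have "attached_class y = attached_class z"
      using step.hyps(2) step_eq[of y z] step_eq[of z y] by (elim disjE) simp_all
    then show ?case using step.IH by simp
  qed simp
qed

end

section \<open>Maps on a group annihilated by powers of the augmentation ideal\<close>

text \<open>
  Maps into an abelian group are considered modulo a subgroup \<open>J\<close>. The set \<open>S\<close> has to generate the
  group as a monoid, so that only products, and no inverses, occur in inductions over it.
\<close>

locale group_maps = group G for G (structure) +
  fixes S :: "'a set" and J :: "'b::ab_group_add set"
  assumes S_closed: "S \<subseteq> carrier G"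
    and generated: "x \<in> carrier G \<Longrightarrow> \<exists>ss. set ss \<subseteq> S \<and> x = foldr (\<otimes>) ss \<one>"
    and zero_J: "0 \<in> J"
    and diff_J: "a \<in> J \<Longrightarrow> b \<in> J \<Longrightarrow> a - b \<in> J"
begin

definition diff_map :: "'a \<Rightarrow> ('a \<Rightarrow> 'b) \<Rightarrow> 'a \<Rightarrow> 'b" where
  "diff_map g F x = F (x \<otimes> g) - F x"

text \<open>
  \<open>degree_below n F\<close> says that modulo \<open>J\<close> the linear extension of \<open>F\<close> vanishes on the \<open>n\<close>-th
  power of the augmentation ideal; asking this for differences along generators is enough, by
  \<open>degree_below_diff_map\<close> below.
\<close>

fun degree_below :: "nat \<Rightarrow> ('a \<Rightarrow> 'b) \<Rightarrow> bool" where
  "degree_below 0 F \<longleftrightarrow> (\<forall>x\<in>carrier G. F x \<in> J)"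
| "degree_below (Suc n) F \<longleftrightarrow> (\<forall>s\<in>S. degree_below n (diff_map s F))"

lemma degree_below_cong:
  "(\<And>x. x \<in> carrier G \<Longrightarrow> F x = F' x) \<Longrightarrow> degree_below n F \<longleftrightarrow> degree_below n F'"
proof (induction n arbitrary: F F')
  case (Suc n)
  have "degree_below n (diff_map s F) \<longleftrightarrow> degree_below n (diff_map s F')" if "s \<in> S" for s
    using that S_closed by (intro Suc.IH) (auto simp: diff_map_def Suc.prems subset_eq)
  then show ?case by simp
qed simp

lemma degree_below_diff:
  "degree_below n F \<Longrightarrow> degree_below n F' \<Longrightarrow> degree_below n (\<lambda>x. F x - F' x)"
proof (induction n arbitrary: F F')
  case (Suc n)
  have "diff_map s (\<lambda>x. F x - F' x) = (\<lambda>x. diff_map s F x - diff_map s F' x)" for s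
    by (simp add: diff_map_def fun_eq_iff)
  then show ?case using Suc by simp
qed (simp add: diff_J)

lemma degree_below_zero: "degree_below n (\<lambda>_. 0)"
  by (induction n) (simp_all add: zero_J diff_map_def[abs_def])

lemma degree_below_add:
  assumes "degree_below n F" "degree_below n F'"
  shows "degree_below n (\<lambda>x. F x + F' x)"
  using degree_below_diff[OF assms(1) degree_below_diff[OF degree_below_zero assms(2)]]
  by simp

lemma degree_below_Suc: "degree_below n F \<Longrightarrow> degree_below (Suc n) F"
proof (induction n arbitrary: F)
  case 0
  then show ?case using S_closed by (auto simp: diff_map_def diff_J)
next
  case (Suc n)
  then show ?case by (metis degree_below.simps(2))
qed

text \<open>
  A translate is the sum of the map and its difference along the same element.
\<close>

lemma degree_below_translate_generator:
  assumes "s \<in> S" "degree_below n F"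
  shows "degree_below n (\<lambda>x. F (x \<otimes> s))"
proof (cases n)
  case 0
  then show ?thesis using assms S_closed by auto
next
  case (Suc l)
  have "degree_below n (diff_map s F)"
    using assms degree_below_Suc[of l "diff_map s F"] by (simp add: Suc)
  from degree_below_add[OF this assms(2)] show ?thesis
    by (simp add: diff_map_def)
qed

lemma generated_induct [consumes 1, case_names one mult]:
  assumes "g \<in> carrier G" "P \<one>"
    "\<And>s h. s \<in> S \<Longrightarrow> h \<in> carrier G \<Longrightarrow> P h \<Longrightarrow> P (s \<otimes> h)"
  shows "P g"
proof -
  have "set ss \<subseteq> S \<Longrightarrow> foldr (\<otimes>) ss \<one> \<in> carrier G \<and> P (foldr (\<otimes>) ss \<one>)" for ss
    using assms(2,3) S_closed by (induction ss) auto
  then show ?thesis using generated[OF assms(1)] by auto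
qed

lemma degree_below_translate:
  assumes "g \<in> carrier G" "degree_below n F"
  shows "degree_below n (\<lambda>x. F (x \<otimes> g))"
  using assms(1)
proof (induction rule: generated_induct)
  case one
  then show ?case using assms(2) degree_below_cong[of "\<lambda>x. F (x \<otimes> \<one>)" F] by simp
next
  case (mult s h)
  have "degree_below n (\<lambda>x. F (x \<otimes> s \<otimes> h))"
    using degree_below_translate_generator[OF mult.hyps(1) mult.IH] .
  moreover have "F (x \<otimes> s \<otimes> h) = F (x \<otimes> (s \<otimes> h))" if "x \<in> carrier G" for x
    using that mult.hyps S_closed by (simp add: m_assoc subset_eq)
  ultimately show ?case
    using degree_below_cong[of "\<lambda>x. F (x \<otimes> s \<otimes> h)" "\<lambda>x. F (x \<otimes> (s \<otimes> h))"] by simp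
qed

text \<open>
  Differences along products reduce to differences along factors, since
  \<open>F (x s h) - F x = (F (x s h) - F (x h)) + (F (x h) - F x)\<close>, where the first bracket is the
  difference along \<open>s\<close> of the translate of \<open>F\<close> by \<open>h\<close>.
\<close>

lemma degree_below_diff_map:
  assumes "g \<in> carrier G" "degree_below (Suc n) F"
  shows "degree_below n (diff_map g F)"
  using assms(1)
proof (induction rule: generated_induct)
  case one
  have "degree_below n (diff_map \<one> F) \<longleftrightarrow> degree_below n (\<lambda>_. 0)"
    by (rule degree_below_cong) (simp add: diff_map_def)
  then show ?case by (simp add: degree_below_zero)
next
  case (mult s h)
  have "degree_below n (diff_map s (\<lambda>x. F (x \<otimes> h)))"
    using degree_below_translate[OF mult.hyps(2) assms(2)] mult.hyps(1) by simp
  from degree_below_add[OF this mult.IH]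
  have "degree_below n (\<lambda>x. diff_map s (\<lambda>x. F (x \<otimes> h)) x + diff_map h F x)" .
  moreover have "diff_map s (\<lambda>x. F (x \<otimes> h)) x + diff_map h F x = diff_map (s \<otimes> h) F x"
    if "x \<in> carrier G" for x
    using that mult.hyps S_closed by (simp add: m_assoc subset_eq diff_map_def)
  ultimately show ?case
    using degree_below_cong[of _ "diff_map (s \<otimes> h) F"] by (metis (no_types, lifting))
qed

lemma lower_central_closed: "lower_central G n \<subseteq> carrier G"
proof (induction n rule: induct_nat_012)
  case (ge2 n)
  have "{x \<otimes> y \<otimes> inv x \<otimes> inv y |x y. x \<in> lower_central G (Suc n) \<and> y \<in> carrier G}
      \<subseteq> carrier G"
    using ge2 by blast
  then show ?case by (simp add: generate_incl)
qed simp_all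

text \<open>
  A difference along an element of \<open>\<Gamma>\<^sub>r\<close> lowers the degree by \<open>r\<close>: it suffices to treat
  commutators \<open>c = x y x\<inverse> y\<inverse>\<close>, and there the difference of \<open>F\<close> along \<open>c\<close> is the commutator of the
  differences along \<open>x\<close> and \<open>y\<close>, applied to the translate of \<open>F\<close> by \<open>x\<inverse> y\<inverse>\<close>.
\<close>

lemma lower_central_diff_map:
  assumes "h \<in> lower_central G (Suc n)" "degree_below (Suc n + l) F"
  shows "degree_below l (diff_map h F)"
  using assms
proof (induction n arbitrary: h l F)
  case 0
  then show ?case by (simp add: degree_below_diff_map)
next
  case (Suc n)
  let ?C = "{x \<otimes> y \<otimes> inv x \<otimes> inv y |x y. x \<in> lower_central G (Suc n) \<and> y \<in> carrier G}"
  have C_closed: "?C \<subseteq> carrier G"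
    using lower_central_closed[of "Suc n"] by blast
  have C: "degree_below l (diff_map c F)" if "c \<in> ?C" for c
  proof -
    from that obtain x y where c: "c = x \<otimes> y \<otimes> inv x \<otimes> inv y"
      and x: "x \<in> lower_central G (Suc n)" and y: "y \<in> carrier G"
      by blast
    have x': "x \<in> carrier G" using x lower_central_closed by blast
    \<comment> \<open>Translating turns \<open>c - 1\<close> into \<open>x y - y x\<close>.\<close>
    define H where "H z = F (z \<otimes> (inv x \<otimes> inv y))" for z
    have H: "degree_below (Suc (Suc n) + l) H"
      unfolding H_def using x' y Suc.prems(2) by (intro degree_below_translate) simp_all
    have "degree_below (Suc n + l) (diff_map y H)"
      using degree_below_diff_map[OF y, of "Suc n + l"] H by simp
    then have 1: "degree_below l (diff_map x (diff_map y H))"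
      by (rule Suc.IH[OF x])
    have "degree_below (Suc l) (diff_map x H)"
      using H by (intro Suc.IH[OF x]) simp
    then have 2: "degree_below l (diff_map y (diff_map x H))"
      by (rule degree_below_diff_map[OF y])
    have "diff_map x (diff_map y H) z - diff_map y (diff_map x H) z = diff_map c F z"
      if z: "z \<in> carrier G" for z
    proof -
      have "x \<otimes> (inv x \<otimes> inv y) = inv y"
        using x' y by (simp add: m_assoc[symmetric])
      then have "z \<otimes> y \<otimes> x \<otimes> (inv x \<otimes> inv y) = z"
        using x' y z by (simp add: m_assoc)
      moreover have "z \<otimes> x \<otimes> y \<otimes> (inv x \<otimes> inv y) = z \<otimes> c"
        using x' y z by (simp add: m_assoc c)
      ultimately show ?thesis
        by (simp add: diff_map_def H_def)
    qed
    then show ?thesis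
      using degree_below_diff[OF 1 2] degree_below_cong[of _ "diff_map c F"]
      by (metis (no_types, lifting))
  qed
  have "h \<in> generate G ?C" using Suc.prems(1) by simp
  then show ?case
  proof (induction rule: generate.induct)
    case one
    have "degree_below l (diff_map \<one> F) \<longleftrightarrow> degree_below l (\<lambda>_. 0)"
      by (rule degree_below_cong) (simp add: diff_map_def)
    then show ?case by (simp add: degree_below_zero)
  next
    case (incl c)
    then show ?case by (rule C)
  next
    case (inv c)
    have c: "c \<in> carrier G" using inv C_closed by blast
    have "degree_below l (\<lambda>x. 0 - diff_map c F (x \<otimes> inv c))"
      using c C[OF inv] by (intro degree_below_diff degree_below_zero degree_below_translate) simp_all
    moreover have "0 - diff_map c F (x \<otimes> inv c) = diff_map (inv c) F x" if "x \<in> carrier G" for x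
      using that c by (simp add: diff_map_def m_assoc)
    ultimately show ?case
      using degree_below_cong[of _ "diff_map (inv c) F"] by (metis (no_types, lifting))
  next
    case (eng a b)
    have ab: "a \<in> carrier G" "b \<in> carrier G"
      using eng generate_incl[OF C_closed] by blast+
    have "degree_below l (\<lambda>x. diff_map b F (x \<otimes> a) + diff_map a F x)"
      using ab eng by (intro degree_below_add degree_below_translate)
    moreover have "diff_map b F (x \<otimes> a) + diff_map a F x = diff_map (a \<otimes> b) F x"
      if "x \<in> carrier G" for x
      using that ab by (simp add: diff_map_def m_assoc)
    ultimately show ?case
      using degree_below_cong[of _ "diff_map (a \<otimes> b) F"] by (metis (no_types, lifting))
  qed
qed

end

section \<open>Maps on words\<close>

definition word_diff :: "'l \<Rightarrow> ('l list \<Rightarrow> 'b::ab_group_add) \<Rightarrow> 'l list \<Rightarrow> 'b" where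
  "word_diff s F z = F (z @ [s]) - F z"

lemma foldr_word_diff_in:
  assumes "\<And>z. z \<in> pv_words m \<Longrightarrow> F z \<in> J" "\<And>a b. a \<in> J \<Longrightarrow> b \<in> J \<Longrightarrow> a - b \<in> J"
    and "ss \<in> pv_words m" "z \<in> pv_words m"
  shows "foldr word_diff ss F z \<in> J"
  using assms(3,4)
proof (induction ss arbitrary: z)
  case (Cons s ss)
  have "[s] \<in> pv_words m" "ss \<in> pv_words m"
    using Cons.prems(1) pv_words_append[of "[s]" ss m] by simp_all
  then show ?case using Cons by (simp add: word_diff_def assms(2))
qed (simp add: assms(1))

text \<open>
  The consequence for maps on words: an invariant map on words descends to the group, and
  the classes of single letters generate it as a monoid.
\<close>

lemma lower_central_PV:
  fixes F :: "pv_word \<Rightarrow> 'b::ab_group_add"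
  assumes inv: "\<And>w w'. (w, w') \<in> pv_equiv m \<Longrightarrow> F w = F w'"
    and J: "0 \<in> J" "\<And>a b. a \<in> J \<Longrightarrow> b \<in> J \<Longrightarrow> a - b \<in> J"
    and diffs: "\<And>ss z. ss \<in> pv_words m \<Longrightarrow> length ss = Suc n \<Longrightarrow> z \<in> pv_words m \<Longrightarrow>
      foldr word_diff ss F z \<in> J"
    and w: "w \<in> pv_words m" "pv_class m w \<in> lower_central (PV m) (Suc n)"
  shows "F w - F [] \<in> J"
proof -
  define S where "S = {pv_class m [s] | s. [s] \<in> pv_words m}"
  have one: "\<one>\<^bsub>PV m\<^esub> = pv_class m []" by (simp add: PV_def)
  have fold_class: "ss \<in> pv_words m \<Longrightarrow>
      foldr (\<otimes>\<^bsub>PV m\<^esub>) (map (\<lambda>s. pv_class m [s]) ss) \<one>\<^bsub>PV m\<^esub> = pv_class m ss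
      \<and> set (map (\<lambda>s. pv_class m [s]) ss) \<subseteq> S" for ss
  proof (induction ss)
    case (Cons s ss)
    have "[s] \<in> pv_words m" "ss \<in> pv_words m"
      using Cons.prems pv_words_append[of "[s]" ss m] by simp_all
    moreover from this have "pv_class m [s] \<in> S" unfolding S_def by blast
    ultimately show ?case using Cons.IH by simp
  qed (simp add: one)
  interpret group_maps "PV m" S J
  proof (intro group_maps.intro group_PV group_maps_axioms.intro)
    show "S \<subseteq> carrier (PV m)" by (auto simp: S_def pv_carrier)
    show "\<exists>ss. set ss \<subseteq> S \<and> x = foldr (\<otimes>\<^bsub>PV m\<^esub>) ss \<one>\<^bsub>PV m\<^esub>" if "x \<in> carrier (PV m)" for x
    proof -
      from that obtain w where "w \<in> pv_words m" "x = pv_class m w"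
        unfolding pv_carrier by (rule imageE)
      then show ?thesis
        by (intro exI[of _ "map (\<lambda>s. pv_class m [s]) w"] conjI)
          (simp_all only: fold_class[of w])
    qed
  qed (fact J)+
  define F' where "F' X = F (SOME w. w \<in> pv_words m \<and> X = pv_class m w)" for X
  have F': "F' (pv_class m w) = F w" if "w \<in> pv_words m" for w
  proof -
    define v where "v = (SOME v. v \<in> pv_words m \<and> pv_class m w = pv_class m v)"
    have v: "v \<in> pv_words m \<and> pv_class m w = pv_class m v"
      unfolding v_def by (rule someI[of _ w]) (simp add: that)
    have "(w, v) \<in> pv_equiv m"
      using conjunct2[OF v] unfolding pv_class_def
      by (rule eq_equiv_class[OF _ equiv_pv_equiv conjunct1[OF v]])
    from inv[OF this] show ?thesis by (simp only: F'_def v_def)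
  qed
  have descend: "degree_below l H'"
    if "\<And>w. w \<in> pv_words m \<Longrightarrow> H' (pv_class m w) = H w"
      and "\<And>ss z. ss \<in> pv_words m \<Longrightarrow> length ss = l \<Longrightarrow> z \<in> pv_words m \<Longrightarrow> foldr word_diff ss H z \<in> J"
    for l H H'
    using that
  proof (induction l arbitrary: H H')
    case 0
    then show ?case using 0(2)[of "[]"] by (auto simp: pv_carrier)
  next
    case (Suc l)
    have "degree_below l (diff_map (pv_class m [s]) H')" if s: "[s] \<in> pv_words m" for s
    proof (rule Suc.IH)
      show "diff_map (pv_class m [s]) H' (pv_class m w) = word_diff s H w" if "w \<in> pv_words m" for w
        using that s by (simp add: diff_map_def word_diff_def Suc.prems(1))
      show "foldr word_diff ss (word_diff s H) z \<in> J"
        if "ss \<in> pv_words m" "length ss = l" "z \<in> pv_words m" for ss z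
        using Suc.prems(2)[of "ss @ [s]" z] that s by simp
    qed
    then have "\<forall>s\<in>S. degree_below l (diff_map s H')"
      unfolding S_def by blast
    then show ?case by (simp only: degree_below.simps)
  qed
  have "degree_below (Suc n) F'"
    using F' diffs by (rule descend)
  then have "degree_below 0 (diff_map (pv_class m w) F')"
    by (intro lower_central_diff_map[OF w(2)]) simp
  then have "F' (\<one>\<^bsub>PV m\<^esub> \<otimes>\<^bsub>PV m\<^esub> pv_class m w) - F' \<one>\<^bsub>PV m\<^esub> \<in> J"
    by (simp add: diff_map_def)
  then show ?thesis using F' w(1) by (simp add: one)
qed

section \<open>Resolving dashed arrows\<close>

lemma sum_PiE_insert:
  fixes g :: "('a \<Rightarrow> int) \<Rightarrow> 'b::ab_group_add"
  assumes "finite X" "a \<notin> X"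
  shows "(\<Sum>\<epsilon>\<in>insert a X \<rightarrow>\<^sub>E {1, -1}. g \<epsilon>) =
    (\<Sum>\<epsilon>\<in>X \<rightarrow>\<^sub>E {1, -1}. g (\<epsilon>(a := 1))) + (\<Sum>\<epsilon>\<in>X \<rightarrow>\<^sub>E {1, -1}. g (\<epsilon>(a := -1)))"
proof -
  have "(\<Sum>\<epsilon>\<in>insert a X \<rightarrow>\<^sub>E {1, -1}. g \<epsilon>) =
      (\<Sum>(y, \<epsilon>)\<in>{1, -1} \<times> (X \<rightarrow>\<^sub>E {1, -1}). g (\<epsilon>(a := y)))"
    unfolding PiE_insert_eq using assms(2)
    by (subst sum.reindex[OF inj_combinator]) (simp_all add: split_def)
  also have "\<dots> = (\<Sum>y\<in>{1, -1}. \<Sum>\<epsilon>\<in>X \<rightarrow>\<^sub>E {1, -1}. g (\<epsilon>(a := y)))"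
    by (simp add: sum.cartesian_product)
  finally show ?thesis by simp
qed

lemma delete_arrows_Un: "delete_arrows X (delete_arrows Y D) = delete_arrows (Y \<union> X) D"
  by (simp add: delete_arrows_def split_def conj_commute)

lemma phi_empty: "phi k D {} = frag_of (link_class k D)"
proof -
  have "delete_arrows {} D = D"
    unfolding delete_arrows_def by (intro map_idI) simp
  then show ?thesis by (simp add: phi_def)
qed

text \<open>
  Resolving one dashed arrow: the two values of its \<open>\<epsilon>\<close> keep it as an ordinary arrow or delete it.
\<close>

lemma phi_insert:
  assumes "finite X" "a \<notin> X"
  shows "phi k D (insert a X) = phi k D X - phi k (delete_arrows {a} D) X"
proof -
  let ?g = "\<lambda>X D \<epsilon>. frag_cmul (\<Prod>b\<in>X. \<epsilon> b) (frag_of (link_class k (delete_arrows {b \<in> X. \<epsilon> b = -1} D)))"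
  have prod: "(\<Prod>b\<in>insert a X. (\<epsilon>(a := y)) b) = y * (\<Prod>b\<in>X. \<epsilon> b)" for \<epsilon> and y :: int
  proof -
    have "(\<Prod>b\<in>X. (\<epsilon>(a := y)) b) = (\<Prod>b\<in>X. \<epsilon> b)"
      using assms(2) by (intro prod.cong) auto
    then show ?thesis using assms by simp
  qed
  have pos: "?g (insert a X) D (\<epsilon>(a := 1)) = ?g X D \<epsilon>" for \<epsilon>
  proof -
    have "{b \<in> insert a X. (\<epsilon>(a := 1)) b = - 1} = {b \<in> X. \<epsilon> b = -1}"
      using assms(2) by auto
    then show ?thesis unfolding prod by simp
  qed
  have neg: "?g (insert a X) D (\<epsilon>(a := -1)) = - ?g X (delete_arrows {a} D) \<epsilon>" for \<epsilon>
  proof -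
    have "{b \<in> insert a X. (\<epsilon>(a := -1)) b = - 1} = {a} \<union> {b \<in> X. \<epsilon> b = -1}"
      using assms(2) by auto
    then show ?thesis unfolding prod delete_arrows_Un by simp
  qed
  have "phi k D (insert a X) = (\<Sum>\<epsilon>\<in>X \<rightarrow>\<^sub>E {1, -1}. ?g X D \<epsilon>) +
      (\<Sum>\<epsilon>\<in>X \<rightarrow>\<^sub>E {1, -1}. - ?g X (delete_arrows {a} D) \<epsilon>)"
    unfolding phi_def sum_PiE_insert[OF assms] pos neg ..
  then show ?thesis
    by (simp only: phi_def[of k D X] phi_def[of k "delete_arrows {a} D" X] sum_negf
        diff_conv_add_uminus)
qed

text \<open>
  Resolving the dashed arrow of a letter keeps or drops the letter, which is a difference of
  the attaching map along this letter.
\<close>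

lemma (in marked_diagram) phi_attached:
  assumes "map snd (U @ V) \<in> pv_words m" "fresh (U @ V)"
  shows "phi k (attached (U @ V)) (fst ` set V) =
    foldr word_diff (map snd V) (\<lambda>w. frag_of (attached_class w)) (map snd U)"
  using assms
proof (induction V arbitrary: U)
  case Nil
  then show ?case using link_class_attached[of U] by (simp add: phi_empty)
next
  case (Cons L V)
  have w: "map snd ((U @ [L]) @ V) \<in> pv_words m" using Cons.prems(1) by simp
  then have w': "map snd (U @ V) \<in> pv_words m"
    using pv_words_append[of "[snd L]" "map snd V" m] by simp
  have f: "fresh ((U @ [L]) @ V)" "fresh (U @ V)"
    using Cons.prems(2) by (auto simp: fresh_def)
  have "fst L \<notin> fst ` set V" using Cons.prems(2) by (simp add: fresh_def)
  then have "phi k (attached (U @ L # V)) (fst ` set (L # V)) =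
      phi k (attached ((U @ [L]) @ V)) (fst ` set V) - phi k (attached (U @ V)) (fst ` set V)"
    using phi_insert[of "fst ` set V" "fst L"] delete_arrows_attached[OF Cons.prems(2)] by simp
  then show ?case
    using Cons.IH[OF w f(1)] Cons.IH[OF w' f(2)] by (simp add: word_diff_def)
qed

section \<open>Finite type invariants\<close>

context comm_group
begin

lemma linear_ext_superset:
  assumes "f \<in> B \<rightarrow> carrier G" "finite B" "Poly_Mapping.keys c \<subseteq> B"
  shows "linear_ext G f c = (\<Otimes>x\<in>B. f x [^] Poly_Mapping.lookup c x)"
  unfolding linear_ext_def using assms
  by (intro finprod_mono_neutral_cong_left) (auto simp: in_keys_iff)

lemma linear_ext_add:
  assumes "f \<in> V \<rightarrow> carrier G" "Poly_Mapping.keys c \<subseteq> V" "Poly_Mapping.keys d \<subseteq> V"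
  shows "linear_ext G f (c + d) = linear_ext G f c \<otimes> linear_ext G f d"
proof -
  let ?B = "Poly_Mapping.keys c \<union> Poly_Mapping.keys d"
  have f: "f \<in> ?B \<rightarrow> carrier G" using assms by auto
  have "linear_ext G f (c + d) = (\<Otimes>x\<in>?B. f x [^] Poly_Mapping.lookup (c + d) x)"
    using f by (rule linear_ext_superset) (simp, rule keys_add)
  also have "\<dots> = (\<Otimes>x\<in>?B. f x [^] Poly_Mapping.lookup c x \<otimes> f x [^] Poly_Mapping.lookup d x)"
    using f by (intro finprod_cong') (auto simp: lookup_add int_pow_mult Pi_iff)
  also have "\<dots> = linear_ext G f c \<otimes> linear_ext G f d"
    using f linear_ext_superset[OF f, of c] linear_ext_superset[OF f, of d]
    by (subst finprod_multf) auto
  finally show ?thesis .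
qed

lemma linear_ext_closed:
  "f \<in> V \<rightarrow> carrier G \<Longrightarrow> Poly_Mapping.keys c \<subseteq> V \<Longrightarrow> linear_ext G f c \<in> carrier G"
  unfolding linear_ext_def by (intro finprod_closed) auto

lemma linear_ext_diff:
  assumes "f \<in> V \<rightarrow> carrier G" "Poly_Mapping.keys c \<subseteq> V" "Poly_Mapping.keys d \<subseteq> V"
  shows "linear_ext G f (c - d) = linear_ext G f c \<otimes> inv (linear_ext G f d)"
proof -
  have k: "Poly_Mapping.keys (c - d) \<subseteq> V" using keys_diff[of c d] assms by blast
  have "linear_ext G f c = linear_ext G f (c - d) \<otimes> linear_ext G f d"
    using linear_ext_add[OF assms(1) k assms(3)] by simp
  then show ?thesis
    using linear_ext_closed[OF assms(1) k] linear_ext_closed[OF assms(1,3)] by (simp add: m_assoc)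
qed

lemma linear_ext_frag_of: "f x \<in> carrier G \<Longrightarrow> linear_ext G f (frag_of x) = f x"
  by (simp add: linear_ext_def)

end

lemma link_class_in_VSL: "gauss_diagram k D \<Longrightarrow> link_class k D \<in> VSL k"
  by (simp add: link_class_def VSL_def quotientI)

text \<open>
  The iterated differences of the attaching map are values of \<open>\<phi>\<close> and hence killed by \<open>f\<close>. The
  general result on the lower central series is applied to the kernel of the linear extension of
  \<open>f\<close>.
\<close>

lemma (in marked_diagram) finite_type_invariant_attached:
  fixes A :: "'c monoid"
  assumes A: "comm_group A" and f: "finite_type_invariant A k n f"
    and w: "w \<in> pv_words m" "pv_class m w \<in> lower_central (PV m) (Suc n)"
  shows "f (attached_class w) = f (attached_class [])"
proof -
  interpret comm_group A by (rule A)
  have f_VSL: "f \<in> VSL k \<rightarrow> carrier A"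
    using f by (simp add: finite_type_invariant_def)
  define J where "J = {c. Poly_Mapping.keys c \<subseteq> VSL k \<and> linear_ext A f c = \<one>\<^bsub>A\<^esub>}"
  let ?F = "\<lambda>w. frag_of (attached_class w)"
  have in_VSL: "attached_class w \<in> VSL k" if "w \<in> pv_words m" for w
    unfolding attached_class_def using that fresh_named
    by (intro link_class_in_VSL) (simp add: gauss_attached)
  have "?F w - ?F [] \<in> J"
  proof (rule lower_central_PV[OF _ _ _ _ w])
    show "?F w = ?F w'" if "(w, w') \<in> pv_equiv m" for w w'
      using attached_class_equiv[OF that] by simp
    show "0 \<in> J" by (simp add: J_def linear_ext_def)
    show "a - b \<in> J" if "a \<in> J" "b \<in> J" for a b
      using that linear_ext_diff[OF f_VSL, of a b] keys_diff[of a b] by (auto simp: J_def)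
    show "foldr word_diff ss ?F z \<in> J"
      if ss: "ss \<in> pv_words m" "length ss = Suc n" and z: "z \<in> pv_words m" for ss z
    proof -
      let ?W = "named new_name (z @ ss)"
      have "map snd ?W = z @ ss" by simp
      then obtain U V where W: "?W = U @ V" and UV: "map snd U = z" "map snd V = ss"
        unfolding map_eq_append_conv by blast
      have words: "map snd (U @ V) \<in> pv_words m" using UV ss z by simp
      have fresh: "fresh (U @ V)" using fresh_named[of "z @ ss"] unfolding W .
      have "card (fst ` set V) = length ss"
        using fresh distinct_card[of "map fst V"] UV(2) by (auto simp: fresh_def)
      moreover have "dashed_diagram k (attached (U @ V)) (fst ` set V)"
        using gauss_attached[OF words] arrows_attached[OF words] fresh
        by (auto simp: dashed_diagram_def)
      ultimately have "linear_ext A f (phi k (attached (U @ V)) (fst ` set V)) = \<one>\<^bsub>A\<^esub>"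
        using f ss(2) by (auto simp: finite_type_invariant_def)
      then have "linear_ext A f (foldr word_diff ss ?F z) = \<one>\<^bsub>A\<^esub>"
        using phi_attached[OF words fresh] UV by simp
      moreover have "foldr word_diff ss ?F z \<in> {c. Poly_Mapping.keys c \<subseteq> VSL k}"
        using ss(1) z in_VSL by (intro foldr_word_diff_in[of m]) (auto dest: keys_diff[THEN subsetD])
      ultimately show ?thesis by (simp add: J_def)
    qed
  qed
  then have "linear_ext A f (?F w - ?F []) = \<one>\<^bsub>A\<^esub>" by (simp add: J_def)
  moreover have v: "attached_class w \<in> VSL k" "attached_class [] \<in> VSL k"
    using in_VSL w(1) by simp_all
  moreover from v have "f (attached_class w) \<in> carrier A" "f (attached_class []) \<in> carrier A"
    using f_VSL by auto
  ultimately show ?thesis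
    using linear_ext_diff[OF f_VSL, of "?F w" "?F []"]
    by (simp add: linear_ext_frag_of inv_solve_right')
qed

lemma finite_type_invariant_L_move:
  fixes A :: "'c monoid"
  assumes "comm_group A" "finite_type_invariant A k n f" "L_move k (Suc n) D D'"
  shows "f (link_class k D) = f (link_class k D')"
proof -
  obtain m w lab \<rho> T where gauss: "gauss_diagram k D" "gauss_diagram k D'"
    and w: "w \<in> pv_words m" "pv_class m w \<in> lower_central (PV m) (Suc n)"
    and T: "marking m T" "D = unmark m T" "D' = attach m w lab \<rho> T"
    using assms(3) unfolding L_move_def by blast
  interpret marked_diagram k m \<rho> T
    using T gauss by unfold_locales simp_all
  have D': "D' = attached (named lab w)"
    by (simp add: T attach_named)
  have "fresh (named lab w)"
    using gauss(2) gauss_attached[of "named lab w"] w(1) by (simp add: D')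
  then have "link_class k D' = attached_class w"
    using link_class_attached[of "named lab w"] w(1) by (simp add: D')
  moreover have "link_class k D = attached_class []"
    using link_class_attached[of "[]"] by (simp add: T attached_Nil fresh_def)
  ultimately show ?thesis
    using finite_type_invariant_attached[OF assms(1,2) w] by simp
qed

theorem proposition6p6:
  fixes k n :: nat and L L' :: vlink
  assumes "k \<ge> 1"
    and "L \<in> VSL k" and "L' \<in> VSL k"
    and "L_equivalent k (Suc n) L L'"
  shows "V_equivalent TYPE('a) k n L L'"
  unfolding V_equivalent_def
proof (intro allI impI, elim conjE)
  fix A :: "'a monoid" and f
  assume A: "comm_group A" and f: "finite_type_invariant A k n f"
  let ?R = "\<lambda>D D'. gauss_diagram k D \<and> gauss_diagram k D' \<and> (move D D' \<or> L_move k (Suc n) D D')"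
  obtain D D' where D: "D \<in> L" "D' \<in> L'" and R: "equivclp ?R D D'"
    using assms(4) unfolding L_equivalent_def L_equiv_diagrams_def by blast
  have step_eq: "f (link_class k X) = f (link_class k Y)" if "?R X Y" for X Y
    using that finite_type_invariant_L_move[OF A f] link_class_eq[OF gauss_equiv_move[of X Y k]]
    by auto
  from R have "f (link_class k D) = f (link_class k D')"
  proof (induction rule: equivclp_induct)
    case (step y z)
    have "f (link_class k y) = f (link_class k z)"
      using step.hyps(2) step_eq[of y z] step_eq[of z y] by (elim disjE) simp_all
    then show ?case using step.IH by simp
  qed simp
  moreover have "X = link_class k E" if "X \<in> VSL k" "E \<in> X" for X E
  proof -
    from that(1) obtain E' where "X = gauss_equiv k `` {E'}"
      unfolding VSL_def by (rule quotientE)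
    then show ?thesis
      using that(2) equiv_class_eq[OF equiv_gauss_equiv, of E' E k] by (simp add: link_class_def)
  qed
  ultimately show "f L = f L'"
    using assms(2,3) D by metis
qed

end
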